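(* Let $(\Omega,\mu)$ be an arbitrary measure space and let $\mathcal{T} = (T_t)_{t \in J}$ be a bounded positive semigroup on $L^1 := L^1(\Omega,\mu)$, where either $J = \mathbb{N}$ or $J = (0,\infty)$. Suppose that for every normalised function $0 \le f \in L^1$ (i.e. $\|f\| = 1$) there exists a function $0 \le h_f \in L^1$ such that $\|(T_tf - h_f)^-\| \to 0$ as $t \to \infty$ and such that $\inf_f \|h_f\| > 0$, where the infimum runs over all normalised $0 \le f \in L^1$. Then $(T_t)$ converges strongly as $t \to \infty$.
   Context: All spaces are real. $\mathbb{N} = \{1,2,\dots\}$. A semigroup on a Banach space $E$ is a family $(T_t)_{t \in J}$ of bounded linear operators on $E$, $J = \mathbb{N}$ or $J = (0,\infty)$, with $T_{t+s} = T_tT_s$ for all $s,t \in J$ (no continuity in $t$ is assumed). It is bounded if $\sup_{t \in J}\|T_t\| < \infty$, and positive if $T_tf \ge 0$ for all $f \ge 0$ and all $t \in J$. For an element $g$ of a Banach lattice, $g^- = (-g)\vee 0$. Strong convergence means convergence as $t \to \infty$ in the strong operator topology to some bounded linear operator on $E$. The measure space need not be $\sigma$-finite. *)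

theory Defs
  imports "HOL-Analysis.Analysis"
begin

text \<open>
  The elements of \<open>L\<^sup>1(M)\<close> are represented by real-valued \<open>M\<close>-integrable functions; equality,
  order and lattice operations in \<open>L\<^sup>1(M)\<close> are the pointwise ones up to \<open>M\<close>-null sets.
  Operators on \<open>L\<^sup>1(M)\<close> are accordingly given by maps on representatives that are compatible
  with equality almost everywhere. No finiteness condition is imposed on \<open>M\<close>.
\<close>

definition L1_norm :: "'a measure \<Rightarrow> ('a \<Rightarrow> real) \<Rightarrow> real" where
  "L1_norm M f = (LINT x|M. \<bar>f x\<bar>)"

definition L1_bounded_linear :: "'a measure \<Rightarrow> (('a \<Rightarrow> real) \<Rightarrow> ('a \<Rightarrow> real)) \<Rightarrow> bool" where
  "L1_bounded_linear M S \<longleftrightarrow>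
     (\<forall>f. integrable M f \<longrightarrow> integrable M (S f)) \<and>
     (\<forall>f g. integrable M f \<longrightarrow> integrable M g \<longrightarrow> (AE x in M. f x = g x) \<longrightarrow>
        (AE x in M. S f x = S g x)) \<and>
     (\<forall>f g. integrable M f \<longrightarrow> integrable M g \<longrightarrow>
        (AE x in M. S (\<lambda>y. f y + g y) x = S f x + S g x)) \<and>
     (\<forall>c f. integrable M f \<longrightarrow> (AE x in M. S (\<lambda>y. c * f y) x = c * S f x)) \<and>
     (\<exists>K. \<forall>f. integrable M f \<longrightarrow> L1_norm M (S f) \<le> K * L1_norm M f)"

text \<open>As for \<^const>\<open>onorm\<close>, the quotient is \<open>0\<close> when \<open>f\<close> vanishes almost everywhere.\<close>

definition L1_onorm :: "'a measure \<Rightarrow> (('a \<Rightarrow> real) \<Rightarrow> ('a \<Rightarrow> real)) \<Rightarrow> real" where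
  "L1_onorm M S = (SUP f\<in>{f. integrable M f}. L1_norm M (S f) / L1_norm M f)"

text \<open>
  The discrete time set \<open>{1, 2, \<dots>}\<close> is embedded into the reals, so that both time sets are
  subsets of the reals; the values of \<open>T\<close> outside \<open>J\<close> play no role.
\<close>

definition time_set :: "real set \<Rightarrow> bool" where
  "time_set J \<longleftrightarrow> J = real ` {1..} \<or> J = {0<..}"

definition L1_semigroup ::
    "'a measure \<Rightarrow> real set \<Rightarrow> (real \<Rightarrow> ('a \<Rightarrow> real) \<Rightarrow> ('a \<Rightarrow> real)) \<Rightarrow> bool" where
  "L1_semigroup M J T \<longleftrightarrow>
     (\<forall>t\<in>J. L1_bounded_linear M (T t)) \<and>
     (\<forall>t\<in>J. \<forall>s\<in>J. \<forall>f. integrable M f \<longrightarrow> (AE x in M. T (t + s) f x = T t (T s f) x))"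

definition L1_bounded_semigroup ::
    "'a measure \<Rightarrow> real set \<Rightarrow> (real \<Rightarrow> ('a \<Rightarrow> real) \<Rightarrow> ('a \<Rightarrow> real)) \<Rightarrow> bool" where
  "L1_bounded_semigroup M J T \<longleftrightarrow>
     L1_semigroup M J T \<and> bdd_above ((\<lambda>t. L1_onorm M (T t)) ` J)"

definition L1_positive ::
    "'a measure \<Rightarrow> real set \<Rightarrow> (real \<Rightarrow> ('a \<Rightarrow> real) \<Rightarrow> ('a \<Rightarrow> real)) \<Rightarrow> bool" where
  "L1_positive M J T \<longleftrightarrow>
     (\<forall>t\<in>J. \<forall>f. integrable M f \<longrightarrow> (AE x in M. 0 \<le> f x) \<longrightarrow> (AE x in M. 0 \<le> T t f x))"

definition L1_normalised :: "'a measure \<Rightarrow> ('a \<Rightarrow> real) set" where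
  "L1_normalised M = {f. integrable M f \<and> (AE x in M. 0 \<le> f x) \<and> L1_norm M f = 1}"

definition neg_part :: "('a \<Rightarrow> real) \<Rightarrow> 'a \<Rightarrow> real" where
  "neg_part g = (\<lambda>x. max (- g x) 0)"

definition at_top_in :: "real set \<Rightarrow> real filter" where
  "at_top_in J = inf at_top (principal J)"

definition L1_strongly_convergent ::
    "'a measure \<Rightarrow> real set \<Rightarrow> (real \<Rightarrow> ('a \<Rightarrow> real) \<Rightarrow> ('a \<Rightarrow> real)) \<Rightarrow> bool" where
  "L1_strongly_convergent M J T \<longleftrightarrow>
     (\<exists>P. L1_bounded_linear M P \<and>
        (\<forall>f. integrable M f \<longrightarrow>
           ((\<lambda>t. L1_norm M (\<lambda>x. T t f x - P f x)) \<longlongrightarrow> 0) (at_top_in J)))"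

lemma at_top_in_continuous: "at_top_in {0<..} = at_top"
  unfolding at_top_in_def by (simp add: inf_absorb1 le_principal eventually_gt_at_top)

lemma filterlim_at_top_in_discrete:
  "filterlim g F (at_top_in (real ` {1..})) \<longleftrightarrow> filterlim (\<lambda>n. g (real n)) F sequentially"
proof -
  have "at_top_in (real ` {1..}) = filtermap real sequentially"
  proof (rule filter_eq_iff[THEN iffD2], intro allI iffI)
    fix P assume "eventually P (at_top_in (real ` {1..}))"
    then obtain N where N: "\<And>x. x \<ge> N \<Longrightarrow> x \<in> real ` {1..} \<Longrightarrow> P x"
      by (auto simp: at_top_in_def eventually_inf_principal eventually_at_top_linorder)
    have "P (real n)" if "n \<ge> max 1 (nat \<lceil>N\<rceil>)" for n
      using that by (intro N) auto
    then show "eventually P (filtermap real sequentially)"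
      unfolding eventually_filtermap eventually_sequentially by blast
  next
    fix P assume "eventually P (filtermap real sequentially)"
    then obtain k where k: "\<And>n. n \<ge> k \<Longrightarrow> P (real n)"
      unfolding eventually_filtermap eventually_sequentially by blast
    have "x \<in> real ` {1..} \<longrightarrow> P x" if "x \<ge> real k" for x
      using that k by auto
    then show "eventually P (at_top_in (real ` {1..}))"
      unfolding at_top_in_def eventually_inf_principal eventually_at_top_linorder by blast
  qed
  then show ?thesis
    by (simp add: filterlim_def filtermap_filtermap)
qed

end

theory Submission
  imports Defs
begin

text \<open>
  Let \<open>K\<close> bound the norms of the operators \<open>T\<^sub>t\<close>, and call \<open>h \<ge> 0\<close> an asymptotic lower bound of
  \<open>f\<close> if \<open>\<parallel>(T\<^sub>t f - h)\<^sup>-\<parallel> \<rightarrow> 0\<close>. By scaling, the hypothesis supplies a constant \<open>c > 0\<close> such that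
  every \<open>f \<ge> 0\<close> has an asymptotic lower bound of norm at least \<open>c \<parallel>f\<parallel>\<close>.

  The asymptotic lower bounds of \<open>f\<close> are closed under binary suprema and norm limits, are mapped
  into themselves by every \<open>T\<^sub>s\<close>, and are bounded in norm. Since the norm of \<open>L\<^sup>1\<close> is additive on
  the positive cone, there is a greatest one (\<open>greatest_lower_bound_exists\<close>), say \<open>h\<close>. As
  \<open>T\<^sub>s h\<close> is again an asymptotic lower bound, \<open>T\<^sub>s h \<le> h\<close>. Hence the orbit of \<open>h\<close> decreases and
  therefore converges, and the hypothesis applied to \<open>h\<close> itself shows that its norm never drops
  below \<open>c \<parallel>h\<parallel> \<ge> c\<^sup>2 \<parallel>f\<parallel>\<close> (\<open>convergent_lower_bound\<close>). So a fixed fraction of every positive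
  orbit converges.

  It remains to iterate (\<open>geometric_approximation\<close>). For large \<open>t\<close> write \<open>T\<^sub>t f = h + g - e\<close>, where
  \<open>g\<close> and \<open>e\<close> are the positive and the negative part of \<open>T\<^sub>t f - h\<close> and \<open>e\<close> is small. Additivity
  of the norm, applied to \<open>T\<^sub>s T\<^sub>t f + T\<^sub>s e = T\<^sub>s h + T\<^sub>s g\<close>, shows that the supremum of the norm
  along the orbit of \<open>g\<close> is, up to a small error, at most \<open>1 - c\<^sup>2 / K\<close> times that along the orbit
  of \<open>f\<close>. Treating \<open>g\<close> in the same way, and so on, one approximates \<open>T\<^sub>r f\<close> by vectors with
  convergent orbits, with an error that stays small under all \<open>T\<^sub>s\<close>. So the orbit of \<open>f\<close> is Cauchy,
  and completeness of \<open>L\<^sup>1\<close> (\<open>L1_complete\<close>) provides the limit.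
\<close>

section \<open>The seminorm of \<open>L\<^sup>1\<close>\<close>

lemma L1_norm_nonneg: "0 \<le> L1_norm M f"
  unfolding L1_norm_def by simp

lemma L1_norm_zero [simp]: "L1_norm M (\<lambda>x. 0) = 0"
  unfolding L1_norm_def by simp

lemma L1_norm_scale: "L1_norm M (\<lambda>x. c * f x) = \<bar>c\<bar> * L1_norm M f"
  unfolding L1_norm_def by (simp add: abs_mult)

lemma L1_norm_commute: "L1_norm M (\<lambda>x. f x - g x) = L1_norm M (\<lambda>x. g x - f x)"
  unfolding L1_norm_def by (simp add: abs_minus_commute)

lemma L1_norm_mono:
  assumes "integrable M f" "integrable M g" "AE x in M. \<bar>f x\<bar> \<le> \<bar>g x\<bar>"
  shows "L1_norm M f \<le> L1_norm M g"
  unfolding L1_norm_def using assms by (intro integral_mono_AE) auto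

lemma L1_norm_cong:
  assumes "integrable M f" "integrable M g" "AE x in M. f x = g x"
  shows "L1_norm M f = L1_norm M g"
  using assms by (intro antisym L1_norm_mono) auto

lemma L1_norm_le_add:
  assumes "integrable M f" "integrable M g" "integrable M h" "AE x in M. \<bar>f x\<bar> \<le> \<bar>g x\<bar> + \<bar>h x\<bar>"
  shows "L1_norm M f \<le> L1_norm M g + L1_norm M h"
proof -
  have "L1_norm M f \<le> (LINT x|M. \<bar>g x\<bar> + \<bar>h x\<bar>)"
    unfolding L1_norm_def using assms by (intro integral_mono_AE) auto
  also have "\<dots> = L1_norm M g + L1_norm M h"
    unfolding L1_norm_def using assms by (intro Bochner_Integration.integral_add) auto
  finally show ?thesis .
qed

lemma L1_norm_add_nonneg:
  assumes "integrable M g" "integrable M h" "AE x in M. 0 \<le> g x" "AE x in M. 0 \<le> h x"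
  shows "L1_norm M (\<lambda>x. g x + h x) = L1_norm M g + L1_norm M h"
proof -
  have "L1_norm M (\<lambda>x. g x + h x) = (LINT x|M. \<bar>g x\<bar> + \<bar>h x\<bar>)"
    unfolding L1_norm_def
  proof (rule integral_cong_AE)
    show "AE x in M. \<bar>g x + h x\<bar> = \<bar>g x\<bar> + \<bar>h x\<bar>"
      using assms(3,4) by eventually_elim auto
  qed (use assms in auto)
  also have "\<dots> = L1_norm M g + L1_norm M h"
    unfolding L1_norm_def using assms by (intro Bochner_Integration.integral_add) auto
  finally show ?thesis .
qed

lemma L1_norm_diff_of_le:
  assumes "integrable M g" "integrable M h" "AE x in M. 0 \<le> g x" "AE x in M. g x \<le> h x"
  shows "L1_norm M (\<lambda>x. h x - g x) = L1_norm M h - L1_norm M g"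
proof -
  have "AE x in M. 0 \<le> h x - g x"
    using assms(4) by eventually_elim auto
  from L1_norm_add_nonneg[OF assms(1) _ assms(3) this] assms show ?thesis
    by simp
qed

lemma L1_norm_eq_0_iff:
  assumes "integrable M f"
  shows "L1_norm M f = 0 \<longleftrightarrow> (AE x in M. f x = 0)"
  unfolding L1_norm_def using assms by (subst integral_nonneg_eq_0_iff_AE) auto

lemma L1_norm_le_all_eps_imp_AE_0:
  assumes "integrable M f" and "\<And>\<epsilon>. 0 < \<epsilon> \<Longrightarrow> L1_norm M f \<le> \<epsilon>"
  shows "AE x in M. f x = 0"
proof -
  have "L1_norm M f \<le> 0"
    by (rule field_le_epsilon) (use assms in auto)
  with L1_norm_nonneg[of M f] L1_norm_eq_0_iff[OF assms(1)] show ?thesis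
    by linarith
qed

lemma neg_part_nonneg: "0 \<le> neg_part g x"
  unfolding neg_part_def by simp

lemma integrable_neg_part [intro]: "integrable M g \<Longrightarrow> integrable M (neg_part g)"
  unfolding neg_part_def by auto

text \<open>
  A Cauchy sequence has a subsequence that converges almost everywhere, and by Fatou's lemma the
  pointwise limit is also the limit in norm.
\<close>

lemma L1_complete:
  fixes F :: "nat \<Rightarrow> 'a \<Rightarrow> real"
  assumes int: "\<And>n. integrable M (F n)"
    and Cauchy: "\<And>\<epsilon>. 0 < \<epsilon> \<Longrightarrow> \<exists>n0. \<forall>m\<ge>n0. \<forall>n\<ge>n0. L1_norm M (\<lambda>x. F m x - F n x) \<le> \<epsilon>"
  obtains g where "integrable M g"
    "\<And>\<epsilon>. 0 < \<epsilon> \<Longrightarrow> \<exists>n0. \<forall>n\<ge>n0. L1_norm M (\<lambda>x. F n x - g x) \<le> \<epsilon>"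
proof -
  note [measurable] = borel_measurable_integrable[OF int]
  have "\<exists>N. \<forall>i\<ge>N. \<forall>j\<ge>N. LINT x|M. norm (F i x - F j x) < e" if "0 < e" for e
  proof -
    obtain N where "\<forall>m\<ge>N. \<forall>n\<ge>N. L1_norm M (\<lambda>x. F m x - F n x) \<le> e / 2"
      using Cauchy[of "e / 2"] \<open>0 < e\<close> by auto
    then have "\<forall>i\<ge>N. \<forall>j\<ge>N. LINT x|M. norm (F i x - F j x) < e"
      using \<open>0 < e\<close> unfolding L1_norm_def real_norm_def by fastforce
    then show ?thesis ..
  qed
  then obtain r where r: "strict_mono r" and AE_Cauchy: "AE x in M. Cauchy (\<lambda>i. F (r i) x)"
    using cauchy_L1_AE_cauchy_subseq[where s = F, OF int] by blast
  define g where "g x = lim (\<lambda>i. F (r i) x)" for x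
  have [measurable]: "g \<in> borel_measurable M"
    unfolding g_def by measurable
  have g: "AE x in M. (\<lambda>i. F (r i) x) \<longlonglongrightarrow> g x"
    using AE_Cauchy unfolding g_def
    by eventually_elim (simp add: Cauchy_convergent_iff convergent_LIMSEQ_iff)
  have Fatou: "(\<integral>\<^sup>+x. ennreal \<bar>F m x - g x\<bar> \<partial>M) \<le> ennreal \<epsilon>"
    if n0: "\<forall>m\<ge>n0. \<forall>n\<ge>n0. L1_norm M (\<lambda>x. F m x - F n x) \<le> \<epsilon>" and "m \<ge> n0" for m n0 \<epsilon>
  proof -
    have "(\<integral>\<^sup>+x. ennreal \<bar>F m x - g x\<bar> \<partial>M) = (\<integral>\<^sup>+x. liminf (\<lambda>i. ennreal \<bar>F m x - F (r i) x\<bar>) \<partial>M)"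
    proof (rule nn_integral_cong_AE)
      show "AE x in M. ennreal \<bar>F m x - g x\<bar> = liminf (\<lambda>i. ennreal \<bar>F m x - F (r i) x\<bar>)"
        using g
      proof eventually_elim
        case (elim x)
        then have "(\<lambda>i. ennreal \<bar>F m x - F (r i) x\<bar>) \<longlonglongrightarrow> ennreal \<bar>F m x - g x\<bar>"
          by (intro tendsto_intros tendsto_ennrealI)
        then show ?case
          by (intro lim_imp_Liminf[symmetric]) auto
      qed
    qed
    also have "\<dots> \<le> liminf (\<lambda>i. \<integral>\<^sup>+x. ennreal \<bar>F m x - F (r i) x\<bar> \<partial>M)"
      by (rule nn_integral_liminf) measurable
    also have "\<dots> = liminf (\<lambda>i. ennreal (L1_norm M (\<lambda>x. F m x - F (r i) x)))"
      unfolding L1_norm_def by (subst nn_integral_eq_integral) (use int in auto)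
    also have "\<dots> \<le> ennreal \<epsilon>"
    proof -
      have "\<forall>\<^sub>F i in sequentially. ennreal (L1_norm M (\<lambda>x. F m x - F (r i) x)) \<le> ennreal \<epsilon>"
        using eventually_ge_at_top[of n0]
      proof eventually_elim
        case (elim i)
        have "n0 \<le> r i"
          using elim seq_suble[OF r, of i] by linarith
        then show ?case
          using n0 \<open>m \<ge> n0\<close> by (intro ennreal_leI) auto
      qed
      then have "liminf (\<lambda>i. ennreal (L1_norm M (\<lambda>x. F m x - F (r i) x))) \<le> liminf (\<lambda>i. ennreal \<epsilon>)"
        by (rule Liminf_mono)
      then show ?thesis
        by (simp add: Liminf_const)
    qed
    finally show ?thesis .
  qed
  show ?thesis
  proof
    obtain n0 where n0: "\<forall>m\<ge>n0. \<forall>n\<ge>n0. L1_norm M (\<lambda>x. F m x - F n x) \<le> 1"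
      using Cauchy[of 1] by auto
    have "integrable M (\<lambda>x. F n0 x - g x)"
    proof (rule integrableI_bounded)
      show "(\<integral>\<^sup>+x. ennreal (norm (F n0 x - g x)) \<partial>M) < \<infinity>"
        using le_less_trans[OF Fatou[OF n0 order_refl] ennreal_less_top] by simp
    qed measurable
    from Bochner_Integration.integrable_diff[OF int[of n0] this]
    show g_int: "integrable M g"
      by simp
    fix \<epsilon> :: real assume "0 < \<epsilon>"
    then obtain n0 where n0: "\<forall>m\<ge>n0. \<forall>n\<ge>n0. L1_norm M (\<lambda>x. F m x - F n x) \<le> \<epsilon>"
      using Cauchy by blast
    have "L1_norm M (\<lambda>x. F n x - g x) \<le> \<epsilon>" if "n \<ge> n0" for n
    proof -
      have "ennreal (L1_norm M (\<lambda>x. F n x - g x)) \<le> ennreal \<epsilon>"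
        using Fatou[OF n0 that] unfolding L1_norm_def
        by (subst nn_integral_eq_integral[symmetric]) (use int g_int in auto)
      then show ?thesis
        using \<open>0 < \<epsilon>\<close> by (simp add: ennreal_le_iff)
    qed
    then show "\<exists>n0. \<forall>n\<ge>n0. L1_norm M (\<lambda>x. F n x - g x) \<le> \<epsilon>"
      by blast
  qed
qed

section \<open>Time sets\<close>

lemma
  assumes "time_set J"
  shows time_set_pos: "t \<in> J \<Longrightarrow> 0 < t"
    and time_set_add: "s \<in> J \<Longrightarrow> t \<in> J \<Longrightarrow> s + t \<in> J"
    and time_set_diff: "s \<in> J \<Longrightarrow> t \<in> J \<Longrightarrow> s < t \<Longrightarrow> t - s \<in> J"
    and time_set_Suc: "real (Suc n) \<in> J"
proof -
  have "J = real ` {1..} \<or> J = {0<..}"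
    using assms unfolding time_set_def .
  then show "t \<in> J \<Longrightarrow> 0 < t"
    by auto
  have "real (Suc n) \<in> real ` {1..}"
    by (intro imageI) simp
  with \<open>J = real ` {1..} \<or> J = {0<..}\<close> show "real (Suc n) \<in> J"
    by auto
  show "s \<in> J \<Longrightarrow> t \<in> J \<Longrightarrow> s + t \<in> J"
    using \<open>J = real ` {1..} \<or> J = {0<..}\<close>
  proof
    assume J: "J = real ` {1..}" "s \<in> J" "t \<in> J"
    then obtain m n where "s = real m" "t = real n" "1 \<le> m"
      by auto
    then have "s + t = real (m + n)" "1 \<le> m + n"
      by auto
    then show "s + t \<in> J"
      unfolding J by blast
  qed auto
  show "s \<in> J \<Longrightarrow> t \<in> J \<Longrightarrow> s < t \<Longrightarrow> t - s \<in> J"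
    using \<open>J = real ` {1..} \<or> J = {0<..}\<close>
  proof
    assume J: "J = real ` {1..}" "s \<in> J" "t \<in> J" "s < t"
    then obtain m n where "s = real m" "t = real n"
      by auto
    with J have "t - s = real (n - m)" "1 \<le> n - m"
      by auto
    then show "t - s \<in> J"
      unfolding J by blast
  qed auto
qed

lemma eventually_at_top_in:
  assumes "time_set J"
  shows "eventually P (at_top_in J) \<longleftrightarrow> (\<exists>t0\<in>J. \<forall>t\<in>J. t0 \<le> t \<longrightarrow> P t)"
proof
  assume "eventually P (at_top_in J)"
  then obtain a where a: "\<forall>t\<ge>a. t \<in> J \<longrightarrow> P t"
    by (auto simp: at_top_in_def eventually_inf_principal eventually_at_top_linorder)
  obtain n where "a \<le> real n"
    using real_arch_simple by blast
  then have "\<forall>t\<in>J. real (Suc n) \<le> t \<longrightarrow> P t"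
    using a by auto
  then show "\<exists>t0\<in>J. \<forall>t\<in>J. t0 \<le> t \<longrightarrow> P t"
    using time_set_Suc[OF assms] by blast
qed (auto simp: at_top_in_def eventually_inf_principal eventually_at_top_linorder)

lemma tendsto_0_at_top_in:
  fixes \<phi> :: "real \<Rightarrow> real"
  assumes "time_set J" and nonneg: "\<And>t. 0 \<le> \<phi> t"
  shows "(\<phi> \<longlongrightarrow> 0) (at_top_in J) \<longleftrightarrow> (\<forall>\<epsilon>>0. \<exists>t0\<in>J. \<forall>t\<in>J. t0 \<le> t \<longrightarrow> \<phi> t \<le> \<epsilon>)"
proof -
  have "(\<phi> \<longlongrightarrow> 0) (at_top_in J) \<longleftrightarrow> (\<forall>\<epsilon>>0. \<exists>t0\<in>J. \<forall>t\<in>J. t0 \<le> t \<longrightarrow> \<phi> t < \<epsilon>)"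
    using nonneg by (simp add: tendsto_iff eventually_at_top_in[OF assms(1)])
  also have "\<dots> \<longleftrightarrow> (\<forall>\<epsilon>>0. \<exists>t0\<in>J. \<forall>t\<in>J. t0 \<le> t \<longrightarrow> \<phi> t \<le> \<epsilon>)"
  proof (intro iffI allI impI)
    fix \<epsilon> :: real
    assume "\<forall>\<epsilon>>0. \<exists>t0\<in>J. \<forall>t\<in>J. t0 \<le> t \<longrightarrow> \<phi> t \<le> \<epsilon>" "0 < \<epsilon>"
    then obtain t0 where "t0 \<in> J" "\<forall>t\<in>J. t0 \<le> t \<longrightarrow> \<phi> t \<le> \<epsilon> / 2"
      by (meson half_gt_zero)
    then show "\<exists>t0\<in>J. \<forall>t\<in>J. t0 \<le> t \<longrightarrow> \<phi> t < \<epsilon>"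
      using \<open>0 < \<epsilon>\<close> by (intro bexI[of _ t0]) force+
  qed (meson less_imp_le)
  finally show ?thesis .
qed

section \<open>Bounded positive semigroups\<close>

lemma L1_norm_le_onorm:
  assumes "L1_bounded_linear M S" "integrable M f"
  shows "L1_norm M (S f) \<le> L1_onorm M S * L1_norm M f"
proof -
  have "\<exists>C. \<forall>f. integrable M f \<longrightarrow> L1_norm M (S f) \<le> C * L1_norm M f"
    using assms(1) unfolding L1_bounded_linear_def by (elim conjE)
  then obtain C where C: "\<And>f. integrable M f \<Longrightarrow> L1_norm M (S f) \<le> C * L1_norm M f"
    by blast
  show ?thesis
  proof (cases "L1_norm M f = 0")
    case True
    then show ?thesis
      using C[OF assms(2)] by simp
  next
    case False
    then have pos: "0 < L1_norm M f"
      using L1_norm_nonneg[of M f] by simp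
    have "L1_norm M (S g) / L1_norm M g \<le> \<bar>C\<bar>" if "integrable M g" for g
    proof (cases "L1_norm M g = 0")
      case False
      then have "0 < L1_norm M g"
        using L1_norm_nonneg[of M g] by simp
      moreover from this have "C * L1_norm M g \<le> \<bar>C\<bar> * L1_norm M g"
        by (intro mult_right_mono) auto
      ultimately show ?thesis
        using order_trans[OF C[OF that]] by (simp only: pos_divide_le_eq)
    qed simp
    then have "bdd_above ((\<lambda>g. L1_norm M (S g) / L1_norm M g) ` {g. integrable M g})"
      by (auto intro!: bdd_aboveI[of _ "\<bar>C\<bar>"])
    then have "L1_norm M (S f) / L1_norm M f \<le> L1_onorm M S"
      unfolding L1_onorm_def using assms(2) by (intro cSUP_upper) auto
    then show ?thesis
      using pos by (simp add: divide_le_eq)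
  qed
qed

locale positive_L1_semigroup =
  fixes M :: "'a measure" and J :: "real set"
    and T :: "real \<Rightarrow> ('a \<Rightarrow> real) \<Rightarrow> ('a \<Rightarrow> real)" and K :: real
  assumes J: "time_set J"
    and semigroup: "L1_semigroup M J T"
    and positive: "L1_positive M J T"
    and K: "1 \<le> K"
    and bound: "\<And>t f. t \<in> J \<Longrightarrow> integrable M f \<Longrightarrow> L1_norm M (T t f) \<le> K * L1_norm M f"
begin

lemma bounded_linear_T: "t \<in> J \<Longrightarrow> L1_bounded_linear M (T t)"
  using semigroup unfolding L1_semigroup_def by simp

lemma T_int [intro, simp]: "t \<in> J \<Longrightarrow> integrable M f \<Longrightarrow> integrable M (T t f)"
  using bounded_linear_T[of t] unfolding L1_bounded_linear_def by simp

lemma T_cong: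
  "t \<in> J \<Longrightarrow> integrable M f \<Longrightarrow> integrable M g \<Longrightarrow> AE x in M. f x = g x \<Longrightarrow>
    AE x in M. T t f x = T t g x"
  using bounded_linear_T[of t] unfolding L1_bounded_linear_def by simp

lemma T_add:
  "t \<in> J \<Longrightarrow> integrable M f \<Longrightarrow> integrable M g \<Longrightarrow>
    AE x in M. T t (\<lambda>y. f y + g y) x = T t f x + T t g x"
  using bounded_linear_T[of t] unfolding L1_bounded_linear_def by simp

lemma T_scale: "t \<in> J \<Longrightarrow> integrable M f \<Longrightarrow> AE x in M. T t (\<lambda>y. c * f y) x = c * T t f x"
  using bounded_linear_T[of t] unfolding L1_bounded_linear_def by simp

lemma T_diff:
  assumes "t \<in> J" "integrable M f" "integrable M g"
  shows "AE x in M. T t (\<lambda>y. f y - g y) x = T t f x - T t g x"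
proof -
  have "AE x in M. T t (\<lambda>y. (f y - g y) + g y) x = T t (\<lambda>y. f y - g y) x + T t g x"
    using assms by (intro T_add) auto
  then show ?thesis
    by eventually_elim simp
qed

lemma T_semigroup:
  "t \<in> J \<Longrightarrow> s \<in> J \<Longrightarrow> integrable M f \<Longrightarrow> AE x in M. T (t + s) f x = T t (T s f) x"
  using semigroup unfolding L1_semigroup_def by simp

lemma T_pos: "t \<in> J \<Longrightarrow> integrable M f \<Longrightarrow> AE x in M. 0 \<le> f x \<Longrightarrow> AE x in M. 0 \<le> T t f x"
  using positive unfolding L1_positive_def by simp

lemma T_mono:
  assumes "t \<in> J" "integrable M f" "integrable M g" "AE x in M. f x \<le> g x"
  shows "AE x in M. T t f x \<le> T t g x"
proof -
  have "AE x in M. 0 \<le> g x - f x"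
    using assms(4) by eventually_elim auto
  then have "AE x in M. 0 \<le> T t (\<lambda>y. g y - f y) x"
    using assms by (intro T_pos) auto
  with T_diff[OF assms(1,3,2)] show ?thesis
    by eventually_elim auto
qed

definition lower_bound :: "('a \<Rightarrow> real) \<Rightarrow> ('a \<Rightarrow> real) \<Rightarrow> bool" where
  "lower_bound f h \<longleftrightarrow> integrable M h \<and> (AE x in M. 0 \<le> h x) \<and>
     (\<forall>\<epsilon>>0. \<exists>t0\<in>J. \<forall>t\<in>J. t0 \<le> t \<longrightarrow> L1_norm M (neg_part (\<lambda>x. T t f x - h x)) \<le> \<epsilon>)"

text \<open>
  Stating convergence of an orbit as a Cauchy condition keeps the limit out of the estimates; it is
  produced only once, by \<open>Cauchy_orbit_limit\<close>.
\<close>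

definition Cauchy_orbit :: "('a \<Rightarrow> real) \<Rightarrow> bool" where
  "Cauchy_orbit f \<longleftrightarrow> integrable M f \<and>
     (\<forall>\<epsilon>>0. \<exists>t0\<in>J. \<forall>s\<in>J. \<forall>t\<in>J. t0 \<le> s \<longrightarrow> t0 \<le> t \<longrightarrow> L1_norm M (\<lambda>x. T s f x - T t f x) \<le> \<epsilon>)"

lemma lower_boundD:
  assumes "lower_bound f h"
  shows "integrable M h" "AE x in M. 0 \<le> h x"
    "0 < \<epsilon> \<Longrightarrow> \<exists>t0\<in>J. \<forall>t\<in>J. t0 \<le> t \<longrightarrow> L1_norm M (neg_part (\<lambda>x. T t f x - h x)) \<le> \<epsilon>"
  using assms unfolding lower_bound_def by blast+

lemma Cauchy_orbitD:
  assumes "Cauchy_orbit f"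
  shows "integrable M f"
    "0 < \<epsilon> \<Longrightarrow> \<exists>t0\<in>J. \<forall>s\<in>J. \<forall>t\<in>J. t0 \<le> s \<longrightarrow> t0 \<le> t \<longrightarrow>
      L1_norm M (\<lambda>x. T s f x - T t f x) \<le> \<epsilon>"
  using assms unfolding Cauchy_orbit_def by simp_all

section \<open>The lattice of asymptotic lower bounds\<close>

lemma lower_bound_max:
  assumes f: "integrable M f" and h: "lower_bound f h" and k: "lower_bound f k"
  shows "lower_bound f (\<lambda>x. max (h x) (k x))"
  unfolding lower_bound_def
proof (intro conjI allI impI)
  note hD = lower_boundD[OF h] and kD = lower_boundD[OF k]
  show "integrable M (\<lambda>x. max (h x) (k x))"
    using hD(1) kD(1) by auto
  show "AE x in M. 0 \<le> max (h x) (k x)"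
    using hD(2) by eventually_elim auto
  fix \<epsilon> :: real assume "0 < \<epsilon>"
  then obtain t1 t2 where
    t1: "t1 \<in> J" "\<forall>t\<in>J. t1 \<le> t \<longrightarrow> L1_norm M (neg_part (\<lambda>x. T t f x - h x)) \<le> \<epsilon> / 2" and
    t2: "t2 \<in> J" "\<forall>t\<in>J. t2 \<le> t \<longrightarrow> L1_norm M (neg_part (\<lambda>x. T t f x - k x)) \<le> \<epsilon> / 2"
    using hD(3)[of "\<epsilon> / 2"] kD(3)[of "\<epsilon> / 2"] by auto
  have "L1_norm M (neg_part (\<lambda>x. T t f x - max (h x) (k x))) \<le> \<epsilon>"
    if t: "t \<in> J" "max t1 t2 \<le> t" for t
  proof -
    have "L1_norm M (neg_part (\<lambda>x. T t f x - max (h x) (k x)))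
        \<le> L1_norm M (neg_part (\<lambda>x. T t f x - h x)) + L1_norm M (neg_part (\<lambda>x. T t f x - k x))"
      using hD(1) kD(1) f t by (intro L1_norm_le_add integrable_neg_part AE_I2) (auto simp: neg_part_def)
    also have "\<dots> \<le> \<epsilon>"
      using t1(2)[rule_format, OF t(1)] t2(2)[rule_format, OF t(1)] t(2) by simp
    finally show ?thesis .
  qed
  moreover have "max t1 t2 \<in> J"
    using t1(1) t2(1) by (simp add: max_def)
  ultimately show "\<exists>t0\<in>J. \<forall>t\<in>J. t0 \<le> t \<longrightarrow>
      L1_norm M (neg_part (\<lambda>x. T t f x - max (h x) (k x))) \<le> \<epsilon>"
    by blast
qed

text \<open>
  If \<open>e = (T\<^sub>u f - h)\<^sup>-\<close>, then \<open>h \<le> T\<^sub>u f + e\<close>, and positivity gives \<open>T\<^sub>s h \<le> T\<^sub>s\<^sub>+\<^sub>u f + T\<^sub>s e\<close>. So the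
  error at time \<open>s + u\<close> is dominated by \<open>T\<^sub>s e\<close>, which is small with \<open>e\<close>.
\<close>

lemma lower_bound_T:
  assumes f: "integrable M f" and h: "lower_bound f h" and s: "s \<in> J"
  shows "lower_bound f (T s h)"
  unfolding lower_bound_def
proof (intro conjI allI impI)
  note hD = lower_boundD[OF h]
  show "integrable M (T s h)" "AE x in M. 0 \<le> T s h x"
    by (intro T_int T_pos s hD)+
  fix \<epsilon> :: real assume "0 < \<epsilon>"
  then obtain t0 where
    t0: "t0 \<in> J" "\<forall>t\<in>J. t0 \<le> t \<longrightarrow> L1_norm M (neg_part (\<lambda>x. T t f x - h x)) \<le> \<epsilon> / K"
    using hD(3)[of "\<epsilon> / K"] K by auto
  have "L1_norm M (neg_part (\<lambda>x. T t f x - T s h x)) \<le> \<epsilon>" if t: "t \<in> J" "s + t0 \<le> t" for t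
  proof -
    define u where "u = t - s"
    have u: "u \<in> J" "t0 \<le> u" "t = s + u"
      using t s time_set_diff[OF J s t(1)] time_set_pos[OF J t0(1)] unfolding u_def by auto
    define e where "e = neg_part (\<lambda>x. T u f x - h x)"
    have e: "integrable M e" "AE x in M. 0 \<le> e x"
      unfolding e_def using f hD(1) u by (auto intro!: integrable_neg_part simp: neg_part_nonneg)
    have "AE x in M. T s h x \<le> T s (\<lambda>x. T u f x + e x) x"
      using f hD(1) e u s by (intro T_mono) (auto simp: e_def neg_part_def)
    moreover have "AE x in M. T s (\<lambda>x. T u f x + e x) x = T s (T u f) x + T s e x"
      using f e u s by (intro T_add) auto
    moreover note T_semigroup[OF s u(1) f] T_pos[OF s e]
    ultimately have "AE x in M. \<bar>neg_part (\<lambda>x. T t f x - T s h x) x\<bar> \<le> \<bar>T s e x\<bar>"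
      unfolding u(3) by eventually_elim (auto simp: neg_part_def)
    then have "L1_norm M (neg_part (\<lambda>x. T t f x - T s h x)) \<le> L1_norm M (T s e)"
      using f hD(1) e s t(1) by (intro L1_norm_mono integrable_neg_part) auto
    also have "\<dots> \<le> K * L1_norm M e"
      by (rule bound[OF s e(1)])
    also have "\<dots> \<le> K * (\<epsilon> / K)"
      using t0(2) u K unfolding e_def by (intro mult_left_mono) auto
    also have "\<dots> = \<epsilon>"
      using K by simp
    finally show ?thesis .
  qed
  with time_set_add[OF J s t0(1)]
  show "\<exists>t0\<in>J. \<forall>t\<in>J. t0 \<le> t \<longrightarrow> L1_norm M (neg_part (\<lambda>x. T t f x - T s h x)) \<le> \<epsilon>"
    by blast
qed

lemma lower_bound_scale:
  assumes f: "integrable M f" and h: "lower_bound f h" and a: "0 < a"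
  shows "lower_bound (\<lambda>x. a * f x) (\<lambda>x. a * h x)"
  unfolding lower_bound_def
proof (intro conjI allI impI)
  note hD = lower_boundD[OF h]
  show "integrable M (\<lambda>x. a * h x)"
    using hD(1) by auto
  show "AE x in M. 0 \<le> a * h x"
    using hD(2) by eventually_elim (use a in auto)
  fix \<epsilon> :: real assume "0 < \<epsilon>"
  then obtain t0 where
    t0: "t0 \<in> J" "\<forall>t\<in>J. t0 \<le> t \<longrightarrow> L1_norm M (neg_part (\<lambda>x. T t f x - h x)) \<le> \<epsilon> / a"
    using hD(3)[of "\<epsilon> / a"] a by auto
  have "L1_norm M (neg_part (\<lambda>x. T t (\<lambda>x. a * f x) x - a * h x)) \<le> \<epsilon>"
    if t: "t \<in> J" "t0 \<le> t" for t
  proof -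
    have "AE x in M. neg_part (\<lambda>x. T t (\<lambda>x. a * f x) x - a * h x) x
        = a * neg_part (\<lambda>x. T t f x - h x) x"
      using T_scale[OF t(1) f, of a]
      by eventually_elim (use a in \<open>simp add: neg_part_def max_mult_distrib_left algebra_simps\<close>)
    then have "L1_norm M (neg_part (\<lambda>x. T t (\<lambda>x. a * f x) x - a * h x))
        = a * L1_norm M (neg_part (\<lambda>x. T t f x - h x))"
      using a f hD(1) t L1_norm_scale[of M a "neg_part (\<lambda>x. T t f x - h x)"]
      by (subst L1_norm_cong[where g = "\<lambda>x. a * neg_part (\<lambda>x. T t f x - h x) x"])
        (auto intro!: integrable_neg_part integrable_mult_right)
    also have "\<dots> \<le> a * (\<epsilon> / a)"
      using t0(2) t a by (intro mult_left_mono) auto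
    finally show ?thesis
      using a by simp
  qed
  with t0(1) show "\<exists>t0\<in>J. \<forall>t\<in>J. t0 \<le> t \<longrightarrow>
      L1_norm M (neg_part (\<lambda>x. T t (\<lambda>x. a * f x) x - a * h x)) \<le> \<epsilon>"
    by blast
qed

text \<open>
  This estimate is used in two ways: with \<open>B = K * L1_norm M f\<close> it bounds the set of all lower
  bounds, and along an orbit whose norm decreases it bounds that norm from below.
\<close>

lemma lower_bound_norm_le:
  assumes f: "integrable M f" and h: "lower_bound f h"
    and s: "s \<in> J" and B: "\<And>t. t \<in> J \<Longrightarrow> s \<le> t \<Longrightarrow> L1_norm M (T t f) \<le> B"
  shows "L1_norm M h \<le> B"
proof (rule field_le_epsilon)
  note hD = lower_boundD[OF h]
  fix \<epsilon> :: real assume "0 < \<epsilon>"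
  then obtain t0 where
    t0: "t0 \<in> J" "\<forall>t\<in>J. t0 \<le> t \<longrightarrow> L1_norm M (neg_part (\<lambda>x. T t f x - h x)) \<le> \<epsilon>"
    using hD(3) by blast
  define t where "t = max s t0"
  have t: "t \<in> J" "s \<le> t" "t0 \<le> t"
    using s t0(1) by (auto simp: t_def max_def)
  have "AE x in M. \<bar>h x\<bar> \<le> \<bar>T t f x\<bar> + \<bar>neg_part (\<lambda>x. T t f x - h x) x\<bar>"
    using hD(2) by eventually_elim (auto simp: neg_part_def)
  then have "L1_norm M h \<le> L1_norm M (T t f) + L1_norm M (neg_part (\<lambda>x. T t f x - h x))"
    using hD(1) f t(1) by (intro L1_norm_le_add integrable_neg_part) auto
  also have "\<dots> \<le> B + \<epsilon>"
    using B[OF t(1,2)] t0(2) t by (intro add_mono) auto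
  finally show "L1_norm M h \<le> B + \<epsilon>" .
qed

lemma lower_bound_limit:
  assumes f: "integrable M f" and H: "\<And>n. lower_bound f (H n)" and g: "integrable M g"
    and lim: "\<And>\<epsilon>. 0 < \<epsilon> \<Longrightarrow> \<exists>n::nat. L1_norm M (\<lambda>x. H n x - g x) \<le> \<epsilon>"
  shows "lower_bound f g"
  unfolding lower_bound_def
proof (intro conjI allI impI)
  note HD = lower_boundD[OF H]
  have "AE x in M. neg_part g x = 0"
  proof (rule L1_norm_le_all_eps_imp_AE_0)
    fix \<epsilon> :: real assume "0 < \<epsilon>"
    then obtain n where n: "L1_norm M (\<lambda>x. H n x - g x) \<le> \<epsilon>"
      using lim by blast
    have "AE x in M. \<bar>neg_part g x\<bar> \<le> \<bar>H n x - g x\<bar>"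
      using HD(2)[of n] by eventually_elim (auto simp: neg_part_def)
    then have "L1_norm M (neg_part g) \<le> L1_norm M (\<lambda>x. H n x - g x)"
      using g HD(1) by (intro L1_norm_mono) auto
    with n show "L1_norm M (neg_part g) \<le> \<epsilon>"
      by simp
  qed (use g in auto)
  then show "AE x in M. 0 \<le> g x"
    by eventually_elim (auto simp: neg_part_def max_def split: if_splits)
  fix \<epsilon> :: real assume "0 < \<epsilon>"
  then obtain n where n: "L1_norm M (\<lambda>x. H n x - g x) \<le> \<epsilon> / 2"
    using lim[of "\<epsilon> / 2"] by auto
  obtain t0 where
    t0: "t0 \<in> J" "\<forall>t\<in>J. t0 \<le> t \<longrightarrow> L1_norm M (neg_part (\<lambda>x. T t f x - H n x)) \<le> \<epsilon> / 2"
    using HD(3)[of "\<epsilon> / 2" n] \<open>0 < \<epsilon>\<close> by auto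
  have "L1_norm M (neg_part (\<lambda>x. T t f x - g x)) \<le> \<epsilon>" if t: "t \<in> J" "t0 \<le> t" for t
  proof -
    have "L1_norm M (neg_part (\<lambda>x. T t f x - g x))
        \<le> L1_norm M (neg_part (\<lambda>x. T t f x - H n x)) + L1_norm M (\<lambda>x. H n x - g x)"
      using HD(1) f g t by (intro L1_norm_le_add integrable_neg_part AE_I2) (auto simp: neg_part_def)
    also have "\<dots> \<le> \<epsilon>"
      using t0(2) t n by fastforce
    finally show ?thesis .
  qed
  with t0(1) show "\<exists>t0\<in>J. \<forall>t\<in>J. t0 \<le> t \<longrightarrow> L1_norm M (neg_part (\<lambda>x. T t f x - g x)) \<le> \<epsilon>"
    by blast
qed (fact g)

text \<open>
  Let \<open>\<sigma>\<close> be the supremum of the norms of all lower bounds. If two of them have norm close to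
  \<open>\<sigma>\<close>, they are close to each other: their maximum is a lower bound as well, so it has norm at
  most \<open>\<sigma>\<close>, and additivity of the norm makes it close to both. Hence every maximising sequence is
  Cauchy, and its limit \<open>h\<close> attains \<open>\<sigma>\<close>. A lower bound \<open>k\<close> that is not below \<open>h\<close> would give the
  lower bound \<open>max h k\<close> of norm greater than \<open>\<sigma>\<close>.
\<close>

lemma greatest_lower_bound_exists:
  assumes f: "integrable M f" and ex: "lower_bound f h0"
  obtains h where "lower_bound f h" "\<And>k. lower_bound f k \<Longrightarrow> AE x in M. k x \<le> h x"
proof -
  define S where "S = L1_norm M ` {h. lower_bound f h}"
  define \<sigma> where "\<sigma> = Sup S"
  have bdd: "bdd_above S"
  proof (rule bdd_aboveI)
    show "y \<le> K * L1_norm M f" if "y \<in> S" for y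
      using that lower_bound_norm_le[OF f _ time_set_Suc[OF J, of 0], of _ "K * L1_norm M f"] bound f
      unfolding S_def by blast
  qed
  have le_\<sigma>: "L1_norm M k \<le> \<sigma>" if "lower_bound f k" for k
    unfolding \<sigma>_def using that by (intro cSup_upper bdd) (auto simp: S_def)
  have "\<exists>h. lower_bound f h \<and> \<sigma> - 1 / real (Suc n) < L1_norm M h" for n
  proof -
    have "\<exists>y\<in>S. \<sigma> - 1 / real (Suc n) < y"
      unfolding \<sigma>_def using ex by (subst less_cSup_iff[symmetric]) (auto simp: S_def bdd[unfolded S_def])
    then show ?thesis
      unfolding S_def by auto
  qed
  then obtain H where H: "\<And>n. lower_bound f (H n)" and H\<sigma>: "\<And>n. \<sigma> - 1 / real (Suc n) < L1_norm M (H n)"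
    by metis
  note HD = lower_boundD[OF H]
  have dist: "L1_norm M (\<lambda>x. H m x - H n x) \<le> 1 / real (Suc m) + 1 / real (Suc n)" for m n
  proof -
    define k where "k x = max (H m x) (H n x)" for x
    have k: "lower_bound f k"
      unfolding k_def by (rule lower_bound_max[OF f H H])
    have *: "L1_norm M (\<lambda>x. k x - H i x) \<le> 1 / real (Suc i)" if "i \<in> {m, n}" for i
    proof -
      have "L1_norm M (\<lambda>x. k x - H i x) = L1_norm M k - L1_norm M (H i)"
        using HD(1) lower_boundD(1)[OF k] that by (intro L1_norm_diff_of_le HD(2) AE_I2) (auto simp: k_def)
      then show ?thesis
        using le_\<sigma>[OF k] H\<sigma>[of i] by linarith
    qed
    have "L1_norm M (\<lambda>x. H m x - H n x) \<le> L1_norm M (\<lambda>x. k x - H m x) + L1_norm M (\<lambda>x. k x - H n x)"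
      using HD(1) lower_boundD(1)[OF k] by (intro L1_norm_le_add AE_I2) auto
    with *[of m] *[of n] show ?thesis
      by simp
  qed
  have small: "\<exists>n0. \<forall>n\<ge>n0. 1 / real (Suc n) \<le> \<epsilon>" if \<epsilon>: "0 < \<epsilon>" for \<epsilon>
  proof -
    obtain n0 where n0: "1 / real (Suc n0) < \<epsilon>"
      by (rule nat_approx_posE[OF \<epsilon>])
    have "1 / real (Suc n) \<le> \<epsilon>" if "n \<ge> n0" for n
    proof -
      have "1 / real (Suc n) \<le> 1 / real (Suc n0)"
        using that by (intro divide_left_mono) auto
      then show ?thesis
        using n0 by linarith
    qed
    then show ?thesis
      by blast
  qed
  have "\<exists>n0. \<forall>m\<ge>n0. \<forall>n\<ge>n0. L1_norm M (\<lambda>x. H m x - H n x) \<le> \<epsilon>" if \<epsilon>: "0 < \<epsilon>" for \<epsilon>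
  proof -
    obtain n0 where n0: "\<forall>n\<ge>n0. 1 / real (Suc n) \<le> \<epsilon> / 2"
      using small[OF half_gt_zero[OF \<epsilon>]] by blast
    have "L1_norm M (\<lambda>x. H m x - H n x) \<le> \<epsilon>" if "n0 \<le> m" "n0 \<le> n" for m n
      using dist[of m n] n0[rule_format, OF that(1)] n0[rule_format, OF that(2)] by linarith
    then show ?thesis
      by blast
  qed
  from L1_complete[OF HD(1) this] obtain h where h: "integrable M h"
    and lim: "\<And>\<epsilon>. 0 < \<epsilon> \<Longrightarrow> \<exists>n0. \<forall>n\<ge>n0. L1_norm M (\<lambda>x. H n x - h x) \<le> \<epsilon>"
    by blast
  have lb_h: "lower_bound f h"
    by (rule lower_bound_limit[where H = H, OF f H h]) (use lim in blast)
  have "\<sigma> \<le> L1_norm M h"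
  proof (rule field_le_epsilon)
    fix \<epsilon> :: real assume "0 < \<epsilon>"
    then have \<epsilon>: "0 < \<epsilon> / 2"
      by simp
    obtain n1 n2 where n1: "\<forall>n\<ge>n1. 1 / real (Suc n) \<le> \<epsilon> / 2"
      and n2: "\<forall>n\<ge>n2. L1_norm M (\<lambda>x. H n x - h x) \<le> \<epsilon> / 2"
      using small[OF \<epsilon>] lim[OF \<epsilon>] by blast
    define n where "n = max n1 n2"
    have "L1_norm M (H n) \<le> L1_norm M h + L1_norm M (\<lambda>x. H n x - h x)"
      using HD(1) h by (intro L1_norm_le_add AE_I2) auto
    moreover have "1 / real (Suc n) \<le> \<epsilon> / 2" "L1_norm M (\<lambda>x. H n x - h x) \<le> \<epsilon> / 2"
      using n1 n2 unfolding n_def by auto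
    ultimately show "\<sigma> \<le> L1_norm M h + \<epsilon>"
      using H\<sigma>[of n] by linarith
  qed
  have "AE x in M. k x \<le> h x" if k: "lower_bound f k" for k
  proof -
    define m where "m x = max (h x) (k x)" for x
    have m: "lower_bound f m"
      unfolding m_def by (rule lower_bound_max[OF f lb_h k])
    have "L1_norm M (\<lambda>x. m x - h x) = L1_norm M m - L1_norm M h"
    proof (rule L1_norm_diff_of_le)
      show "AE x in M. h x \<le> m x"
        by (simp add: m_def)
    qed (rule lower_boundD[OF lb_h] lower_boundD[OF m])+
    then have "L1_norm M (\<lambda>x. m x - h x) = 0"
      using le_\<sigma>[OF m] \<open>\<sigma> \<le> L1_norm M h\<close> L1_norm_nonneg[of M "\<lambda>x. m x - h x"] by linarith
    then have "AE x in M. m x - h x = 0"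
      using L1_norm_eq_0_iff[of M "\<lambda>x. m x - h x"] h lower_boundD(1)[OF m] by auto
    then show ?thesis
      by eventually_elim (auto simp: m_def max_def split: if_splits)
  qed
  with lb_h that show ?thesis
    by blast
qed

section \<open>Convergent orbits\<close>

lemma Cauchy_orbit_zero: "Cauchy_orbit (\<lambda>x. 0)"
proof -
  have zero: "AE x in M. T t (\<lambda>x. 0) x = 0" if "t \<in> J" for t
    using T_scale[OF that, of "\<lambda>x. 0" 0] by simp
  have "L1_norm M (\<lambda>x. T s (\<lambda>x. 0) x - T t (\<lambda>x. 0) x) = 0" if "s \<in> J" "t \<in> J" for s t
  proof -
    have "AE x in M. T s (\<lambda>x. 0) x - T t (\<lambda>x. 0) x = 0"
      using zero[OF that(1)] zero[OF that(2)] by eventually_elim auto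
    then show ?thesis
      using that by (subst L1_norm_eq_0_iff) auto
  qed
  then show ?thesis
    unfolding Cauchy_orbit_def using time_set_Suc[OF J, of 0] by fastforce
qed

lemma Cauchy_orbit_add:
  assumes "Cauchy_orbit f" "Cauchy_orbit g"
  shows "Cauchy_orbit (\<lambda>x. f x + g x)"
  unfolding Cauchy_orbit_def
proof (intro conjI allI impI)
  have fg: "integrable M f" "integrable M g"
    using assms by (auto dest: Cauchy_orbitD(1))
  then show "integrable M (\<lambda>x. f x + g x)"
    by auto
  fix \<epsilon> :: real assume "0 < \<epsilon>"
  then have \<epsilon>: "0 < \<epsilon> / 2"
    by simp
  obtain t1 where t1: "t1 \<in> J" "\<forall>s\<in>J. \<forall>t\<in>J. t1 \<le> s \<longrightarrow> t1 \<le> t \<longrightarrow>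
        L1_norm M (\<lambda>x. T s f x - T t f x) \<le> \<epsilon> / 2"
    using Cauchy_orbitD(2)[OF assms(1) \<epsilon>] by blast
  obtain t2 where t2: "t2 \<in> J" "\<forall>s\<in>J. \<forall>t\<in>J. t2 \<le> s \<longrightarrow> t2 \<le> t \<longrightarrow>
        L1_norm M (\<lambda>x. T s g x - T t g x) \<le> \<epsilon> / 2"
    using Cauchy_orbitD(2)[OF assms(2) \<epsilon>] by blast
  have "L1_norm M (\<lambda>x. T s (\<lambda>x. f x + g x) x - T t (\<lambda>x. f x + g x) x) \<le> \<epsilon>"
    if st: "s \<in> J" "t \<in> J" "max t1 t2 \<le> s" "max t1 t2 \<le> t" for s t
  proof -
    have "AE x in M. \<bar>T s (\<lambda>x. f x + g x) x - T t (\<lambda>x. f x + g x) x\<bar>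
        \<le> \<bar>T s f x - T t f x\<bar> + \<bar>T s g x - T t g x\<bar>"
      using T_add[OF st(1) fg] T_add[OF st(2) fg] by eventually_elim auto
    then have "L1_norm M (\<lambda>x. T s (\<lambda>x. f x + g x) x - T t (\<lambda>x. f x + g x) x)
        \<le> L1_norm M (\<lambda>x. T s f x - T t f x) + L1_norm M (\<lambda>x. T s g x - T t g x)"
      using fg st by (intro L1_norm_le_add) auto
    moreover have "L1_norm M (\<lambda>x. T s f x - T t f x) \<le> \<epsilon> / 2"
      "L1_norm M (\<lambda>x. T s g x - T t g x) \<le> \<epsilon> / 2"
      using t1(2) t2(2) st by auto
    ultimately show ?thesis
      by linarith
  qed
  moreover have "max t1 t2 \<in> J"
    using t1(1) t2(1) by (simp add: max_def)
  ultimately show "\<exists>t0\<in>J. \<forall>s\<in>J. \<forall>t\<in>J. t0 \<le> s \<longrightarrow> t0 \<le> t \<longrightarrow>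
      L1_norm M (\<lambda>x. T s (\<lambda>x. f x + g x) x - T t (\<lambda>x. f x + g x) x) \<le> \<epsilon>"
    by blast
qed

lemma Cauchy_orbit_scale:
  assumes "Cauchy_orbit f"
  shows "Cauchy_orbit (\<lambda>x. c * f x)"
  unfolding Cauchy_orbit_def
proof (intro conjI allI impI)
  have f: "integrable M f"
    using assms by (auto dest: Cauchy_orbitD(1))
  then show "integrable M (\<lambda>x. c * f x)"
    by auto
  fix \<epsilon> :: real assume "0 < \<epsilon>"
  then have \<epsilon>: "0 < \<epsilon> / (\<bar>c\<bar> + 1)"
    by (intro divide_pos_pos) auto
  obtain t0 where t0: "t0 \<in> J" "\<forall>s\<in>J. \<forall>t\<in>J. t0 \<le> s \<longrightarrow> t0 \<le> t \<longrightarrow>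
        L1_norm M (\<lambda>x. T s f x - T t f x) \<le> \<epsilon> / (\<bar>c\<bar> + 1)"
    using Cauchy_orbitD(2)[OF assms \<epsilon>] by blast
  have "L1_norm M (\<lambda>x. T s (\<lambda>x. c * f x) x - T t (\<lambda>x. c * f x) x) \<le> \<epsilon>"
    if st: "s \<in> J" "t \<in> J" "t0 \<le> s" "t0 \<le> t" for s t
  proof -
    have "AE x in M. T s (\<lambda>x. c * f x) x - T t (\<lambda>x. c * f x) x = c * (T s f x - T t f x)"
      using T_scale[OF st(1) f, of c] T_scale[OF st(2) f, of c]
      by eventually_elim (simp add: algebra_simps)
    then have "L1_norm M (\<lambda>x. T s (\<lambda>x. c * f x) x - T t (\<lambda>x. c * f x) x)
        = \<bar>c\<bar> * L1_norm M (\<lambda>x. T s f x - T t f x)"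
      using f st by (subst L1_norm_scale[symmetric], intro L1_norm_cong) auto
    also have "\<dots> \<le> \<bar>c\<bar> * (\<epsilon> / (\<bar>c\<bar> + 1))"
      using t0(2) st by (intro mult_left_mono) auto
    also have "\<dots> \<le> \<epsilon>"
      using \<open>0 < \<epsilon>\<close> by (simp add: field_simps)
    finally show ?thesis .
  qed
  with t0(1) show "\<exists>t0\<in>J. \<forall>s\<in>J. \<forall>t\<in>J. t0 \<le> s \<longrightarrow> t0 \<le> t \<longrightarrow>
      L1_norm M (\<lambda>x. T s (\<lambda>x. c * f x) x - T t (\<lambda>x. c * f x) x) \<le> \<epsilon>"
    by blast
qed

lemma Cauchy_orbit_T:
  assumes "Cauchy_orbit f" and r: "r \<in> J"
  shows "Cauchy_orbit (T r f)"
  unfolding Cauchy_orbit_def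
proof (intro conjI allI impI)
  have f: "integrable M f"
    using assms by (auto dest: Cauchy_orbitD(1))
  then show "integrable M (T r f)"
    using r by auto
  fix \<epsilon> :: real assume "0 < \<epsilon>"
  from Cauchy_orbitD(2)[OF assms(1) this] obtain t0 where
    t0: "t0 \<in> J" "\<forall>s\<in>J. \<forall>t\<in>J. t0 \<le> s \<longrightarrow> t0 \<le> t \<longrightarrow>
        L1_norm M (\<lambda>x. T s f x - T t f x) \<le> \<epsilon>"
    by blast
  have "L1_norm M (\<lambda>x. T s (T r f) x - T t (T r f) x) \<le> \<epsilon>"
    if st: "s \<in> J" "t \<in> J" "t0 \<le> s" "t0 \<le> t" for s t
  proof -
    have sr: "s + r \<in> J" "t + r \<in> J" "t0 \<le> s + r" "t0 \<le> t + r"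
      using st r time_set_add[OF J] time_set_pos[OF J r] by auto
    have "AE x in M. T s (T r f) x - T t (T r f) x = T (s + r) f x - T (t + r) f x"
      using T_semigroup[OF st(1) r f] T_semigroup[OF st(2) r f] by eventually_elim auto
    then have "L1_norm M (\<lambda>x. T s (T r f) x - T t (T r f) x)
        = L1_norm M (\<lambda>x. T (s + r) f x - T (t + r) f x)"
      using f st sr r by (intro L1_norm_cong) auto
    then show ?thesis
      using t0(2) sr by simp
  qed
  with t0(1) show "\<exists>t0\<in>J. \<forall>s\<in>J. \<forall>t\<in>J. t0 \<le> s \<longrightarrow> t0 \<le> t \<longrightarrow>
      L1_norm M (\<lambda>x. T s (T r f) x - T t (T r f) x) \<le> \<epsilon>"
    by blast
qed

lemma Cauchy_orbit_approx:
  assumes f: "integrable M f"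
    and approx: "\<And>\<epsilon>. 0 < \<epsilon> \<Longrightarrow> \<exists>r\<in>J. \<exists>u. Cauchy_orbit u \<and>
          (\<forall>s\<in>J. L1_norm M (\<lambda>x. T (s + r) f x - T s u x) \<le> \<epsilon>)"
  shows "Cauchy_orbit f"
  unfolding Cauchy_orbit_def
proof (intro conjI allI impI)
  fix \<epsilon> :: real assume "0 < \<epsilon>"
  then have \<epsilon>: "0 < \<epsilon> / 3"
    by simp
  from approx[OF this] obtain r u where r: "r \<in> J" and u: "Cauchy_orbit u"
    and close: "\<And>s. s \<in> J \<Longrightarrow> L1_norm M (\<lambda>x. T (s + r) f x - T s u x) \<le> \<epsilon> / 3"
    by blast
  have u_int: "integrable M u"
    using u by (rule Cauchy_orbitD(1))
  obtain t0 where t0: "t0 \<in> J" "\<forall>s\<in>J. \<forall>t\<in>J. t0 \<le> s \<longrightarrow> t0 \<le> t \<longrightarrow>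
        L1_norm M (\<lambda>x. T s u x - T t u x) \<le> \<epsilon> / 3"
    using Cauchy_orbitD(2)[OF u \<epsilon>] by blast
  have "L1_norm M (\<lambda>x. T s f x - T t f x) \<le> \<epsilon>"
    if st: "s \<in> J" "t \<in> J" "t0 + r \<le> s" "t0 + r \<le> t" for s t
  proof -
    have s': "s - r \<in> J" "t - r \<in> J"
      using st r time_set_pos[OF J t0(1)] by (auto intro!: time_set_diff[OF J])
    have "L1_norm M (\<lambda>x. T s f x - T t f x)
        \<le> L1_norm M (\<lambda>x. T s f x - T (s - r) u x) + L1_norm M (\<lambda>x. T (s - r) u x - T t f x)"
      using f u_int st s' by (intro L1_norm_le_add AE_I2) auto
    also have "L1_norm M (\<lambda>x. T (s - r) u x - T t f x)
        \<le> L1_norm M (\<lambda>x. T (s - r) u x - T (t - r) u x) + L1_norm M (\<lambda>x. T t f x - T (t - r) u x)"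
      using f u_int st s' by (intro L1_norm_le_add AE_I2) auto
    finally show ?thesis
      using close[OF s'(1)] close[OF s'(2)] t0(2)[rule_format, OF s'] st by simp
  qed
  with time_set_add[OF J t0(1) r]
  show "\<exists>t0\<in>J. \<forall>s\<in>J. \<forall>t\<in>J. t0 \<le> s \<longrightarrow> t0 \<le> t \<longrightarrow> L1_norm M (\<lambda>x. T s f x - T t f x) \<le> \<epsilon>"
    by blast
qed (fact f)

lemma Cauchy_orbit_limit:
  assumes "Cauchy_orbit f"
  obtains g where "integrable M g" "((\<lambda>t. L1_norm M (\<lambda>x. T t f x - g x)) \<longlongrightarrow> 0) (at_top_in J)"
proof -
  have f: "integrable M f"
    using assms by (rule Cauchy_orbitD(1))
  define F where "F n = T (real (Suc n)) f" for n
  have F_int: "integrable M (F n)" for n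
    unfolding F_def by (intro T_int time_set_Suc[OF J] f)
  have close: "\<exists>t0\<in>J. \<exists>n0. \<forall>t\<in>J. \<forall>n\<ge>n0. t0 \<le> t \<longrightarrow> L1_norm M (\<lambda>x. T t f x - F n x) \<le> \<epsilon>"
    if \<epsilon>: "0 < \<epsilon>" for \<epsilon>
  proof -
    obtain t0 where t0: "t0 \<in> J" "\<forall>s\<in>J. \<forall>t\<in>J. t0 \<le> s \<longrightarrow> t0 \<le> t \<longrightarrow>
        L1_norm M (\<lambda>x. T s f x - T t f x) \<le> \<epsilon>"
      using Cauchy_orbitD(2)[OF assms \<epsilon>] by blast
    obtain n0 where "t0 \<le> real n0"
      using real_arch_simple by blast
    then have "\<forall>t\<in>J. \<forall>n\<ge>n0. t0 \<le> t \<longrightarrow> L1_norm M (\<lambda>x. T t f x - F n x) \<le> \<epsilon>"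
      using t0(2) time_set_Suc[OF J] unfolding F_def by simp
    with t0(1) show ?thesis
      by blast
  qed
  have "\<exists>n0. \<forall>m\<ge>n0. \<forall>n\<ge>n0. L1_norm M (\<lambda>x. F m x - F n x) \<le> \<epsilon>" if \<epsilon>: "0 < \<epsilon>" for \<epsilon>
  proof -
    obtain t0 n0 where
      t0: "\<And>t n. t \<in> J \<Longrightarrow> n0 \<le> n \<Longrightarrow> t0 \<le> t \<Longrightarrow> L1_norm M (\<lambda>x. T t f x - F n x) \<le> \<epsilon>"
      using close[OF \<epsilon>] by blast
    obtain n1 where "t0 \<le> real n1"
      using real_arch_simple by blast
    then have "\<forall>m\<ge>max n0 n1. \<forall>n\<ge>max n0 n1. L1_norm M (\<lambda>x. F m x - F n x) \<le> \<epsilon>"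
      using t0[OF time_set_Suc[OF J]] unfolding F_def[of m for m] by (simp add: F_def)
    then show ?thesis ..
  qed
  from L1_complete[OF F_int this] obtain g where g: "integrable M g"
    and lim: "\<And>\<epsilon>. 0 < \<epsilon> \<Longrightarrow> \<exists>n0. \<forall>n\<ge>n0. L1_norm M (\<lambda>x. F n x - g x) \<le> \<epsilon>"
    by blast
  have "\<exists>t0\<in>J. \<forall>t\<in>J. t0 \<le> t \<longrightarrow> L1_norm M (\<lambda>x. T t f x - g x) \<le> \<epsilon>" if "0 < \<epsilon>" for \<epsilon>
  proof -
    from that have \<epsilon>: "0 < \<epsilon> / 2"
      by simp
    obtain t0 n0 where t0: "t0 \<in> J"
      "\<And>t n. t \<in> J \<Longrightarrow> n0 \<le> n \<Longrightarrow> t0 \<le> t \<Longrightarrow> L1_norm M (\<lambda>x. T t f x - F n x) \<le> \<epsilon> / 2"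
      using close[OF \<epsilon>] by blast
    obtain n1 where n1: "\<forall>n\<ge>n1. L1_norm M (\<lambda>x. F n x - g x) \<le> \<epsilon> / 2"
      using lim[OF \<epsilon>] by blast
    define n where "n = max n0 n1"
    have "L1_norm M (\<lambda>x. T t f x - g x) \<le> \<epsilon>" if t: "t \<in> J" "t0 \<le> t" for t
    proof -
      have "L1_norm M (\<lambda>x. T t f x - g x)
          \<le> L1_norm M (\<lambda>x. T t f x - F n x) + L1_norm M (\<lambda>x. F n x - g x)"
        using f g F_int t by (intro L1_norm_le_add AE_I2) auto
      moreover have "L1_norm M (\<lambda>x. T t f x - F n x) \<le> \<epsilon> / 2"
        using t0(2)[OF t(1) _ t(2)] unfolding n_def by simp
      moreover have "L1_norm M (\<lambda>x. F n x - g x) \<le> \<epsilon> / 2"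
        using n1 unfolding n_def by simp
      ultimately show ?thesis
        by linarith
    qed
    with t0(1) show ?thesis
      by blast
  qed
  then have "((\<lambda>t. L1_norm M (\<lambda>x. T t f x - g x)) \<longlongrightarrow> 0) (at_top_in J)"
    by (subst tendsto_0_at_top_in[OF J L1_norm_nonneg]) blast
  with g that show ?thesis
    by blast
qed

text \<open>
  The orbit of \<open>h\<close> decreases, so distances between its members are differences of their norms,
  and the norms form a decreasing family of nonnegative reals.
\<close>

lemma Cauchy_orbit_antitone:
  assumes h: "integrable M h" "AE x in M. 0 \<le> h x"
    and dec: "\<And>s. s \<in> J \<Longrightarrow> AE x in M. T s h x \<le> h x"
  shows "Cauchy_orbit h"
    and "\<And>s t. s \<in> J \<Longrightarrow> t \<in> J \<Longrightarrow> s \<le> t \<Longrightarrow> L1_norm M (T t h) \<le> L1_norm M (T s h)"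
proof -
  have anti: "AE x in M. T t h x \<le> T s h x" if "s \<in> J" "t \<in> J" "s \<le> t" for s t
  proof (cases "s = t")
    case False
    with that have ts: "t - s \<in> J"
      by (intro time_set_diff[OF J]) auto
    have "AE x in M. T s (T (t - s) h) x \<le> T s h x"
      using h ts that by (intro T_mono dec) auto
    with T_semigroup[OF that(1) ts h(1)] show ?thesis
      by eventually_elim auto
  qed simp
  show norm_anti: "L1_norm M (T t h) \<le> L1_norm M (T s h)" if "s \<in> J" "t \<in> J" "s \<le> t" for s t
  proof (rule L1_norm_mono)
    show "AE x in M. \<bar>T t h x\<bar> \<le> \<bar>T s h x\<bar>"
      using anti[OF that] T_pos[OF that(2) h] by eventually_elim auto
  qed (use that h in auto)
  define \<iota> where "\<iota> = (INF s\<in>J. L1_norm M (T s h))"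
  have \<iota>_le: "\<iota> \<le> L1_norm M (T s h)" if "s \<in> J" for s
    unfolding \<iota>_def using that by (intro cINF_lower bdd_belowI2[of _ 0] L1_norm_nonneg)
  have ordered: "L1_norm M (\<lambda>x. T s h x - T t h x) = L1_norm M (T s h) - L1_norm M (T t h)"
    if "s \<in> J" "t \<in> J" "s \<le> t" for s t
    using anti[OF that] T_pos[OF that(2) h] h that by (intro L1_norm_diff_of_le) auto
  show "Cauchy_orbit h"
    unfolding Cauchy_orbit_def
  proof (intro conjI allI impI)
    fix \<epsilon> :: real assume "0 < \<epsilon>"
    have "J \<noteq> {}"
      using time_set_Suc[OF J] by blast
    moreover have "bdd_below ((\<lambda>s. L1_norm M (T s h)) ` J)"
      by (intro bdd_belowI2[of _ 0] L1_norm_nonneg)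
    ultimately obtain t0 where t0: "t0 \<in> J" "L1_norm M (T t0 h) < \<iota> + \<epsilon>"
      using \<open>0 < \<epsilon>\<close> cINF_less_iff[of J "\<lambda>s. L1_norm M (T s h)" "\<iota> + \<epsilon>"]
      by (auto simp: \<iota>_def[symmetric])
    have "L1_norm M (\<lambda>x. T s h x - T t h x) \<le> \<epsilon>"
      if st: "s \<in> J" "t \<in> J" "t0 \<le> s" "t0 \<le> t" for s t
    proof -
      have "L1_norm M (\<lambda>x. T s h x - T t h x) = \<bar>L1_norm M (T s h) - L1_norm M (T t h)\<bar>"
      proof (cases "s \<le> t")
        case True
        then show ?thesis
          using ordered[of s t] norm_anti[of s t] st by simp
      next
        case False
        then show ?thesis
          using ordered[of t s] norm_anti[of t s] st by (subst L1_norm_commute) simp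
      qed
      then show ?thesis
        using \<iota>_le[OF st(1)] \<iota>_le[OF st(2)] norm_anti[OF t0(1) st(1,3)] norm_anti[OF t0(1) st(2,4)] t0(2)
        by linarith
    qed
    with t0(1) show "\<exists>t0\<in>J. \<forall>s\<in>J. \<forall>t\<in>J. t0 \<le> s \<longrightarrow> t0 \<le> t \<longrightarrow>
        L1_norm M (\<lambda>x. T s h x - T t h x) \<le> \<epsilon>"
      by blast
  qed (fact h)
qed

text \<open>
  The limits are chosen representative by representative; linearity and compatibility with equality
  almost everywhere follow because a limit in \<open>L\<^sup>1\<close> is unique up to null sets.
\<close>

lemma strongly_convergent_if_Cauchy_orbits:
  assumes "\<And>f. integrable M f \<Longrightarrow> Cauchy_orbit f"
  shows "L1_strongly_convergent M J T"
proof -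
  have "\<exists>g. integrable M g \<and> ((\<lambda>t. L1_norm M (\<lambda>x. T t f x - g x)) \<longlongrightarrow> 0) (at_top_in J)"
    if "integrable M f" for f
    using Cauchy_orbit_limit[OF assms[OF that]] by blast
  then obtain P where P_int: "\<And>f. integrable M f \<Longrightarrow> integrable M (P f)"
    and P: "\<And>f. integrable M f \<Longrightarrow> ((\<lambda>t. L1_norm M (\<lambda>x. T t f x - P f x)) \<longlongrightarrow> 0) (at_top_in J)"
    by metis
  have near: "\<exists>t0\<in>J. \<forall>t\<in>J. t0 \<le> t \<longrightarrow> L1_norm M (\<lambda>x. T t f x - P f x) \<le> \<epsilon>"
    if "integrable M f" "0 < \<epsilon>" for f \<epsilon>
    using P[OF that(1)] that(2) by (subst (asm) tendsto_0_at_top_in[OF J L1_norm_nonneg]) blast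
  have unique: "AE x in M. P f x = g x" if f: "integrable M f" and g: "integrable M g"
    and lim: "\<And>\<epsilon>. 0 < \<epsilon> \<Longrightarrow> \<exists>t0\<in>J. \<forall>t\<in>J. t0 \<le> t \<longrightarrow> L1_norm M (\<lambda>x. T t f x - g x) \<le> \<epsilon>" for f g
  proof -
    have "AE x in M. P f x - g x = 0"
    proof (rule L1_norm_le_all_eps_imp_AE_0)
      fix \<epsilon> :: real assume "0 < \<epsilon>"
      then have \<epsilon>: "0 < \<epsilon> / 2"
        by simp
      obtain t1 t2 where
        t1: "t1 \<in> J" "\<forall>t\<in>J. t1 \<le> t \<longrightarrow> L1_norm M (\<lambda>x. T t f x - P f x) \<le> \<epsilon> / 2" and
        t2: "t2 \<in> J" "\<forall>t\<in>J. t2 \<le> t \<longrightarrow> L1_norm M (\<lambda>x. T t f x - g x) \<le> \<epsilon> / 2"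
        using near[OF f \<epsilon>] lim[OF \<epsilon>] by blast
      define t where "t = t1 + t2"
      have t: "t \<in> J" "t1 \<le> t" "t2 \<le> t"
        using t1(1) t2(1) time_set_add[OF J] time_set_pos[OF J] unfolding t_def by (auto simp: less_imp_le)
      have "L1_norm M (\<lambda>x. P f x - g x)
          \<le> L1_norm M (\<lambda>x. T t f x - P f x) + L1_norm M (\<lambda>x. T t f x - g x)"
        using f g P_int t by (intro L1_norm_le_add AE_I2) auto
      also have "\<dots> \<le> \<epsilon>"
        using t1(2)[rule_format, OF t(1,2)] t2(2)[rule_format, OF t(1,3)] by linarith
      finally show "L1_norm M (\<lambda>x. P f x - g x) \<le> \<epsilon>" .
    qed (use g P_int[OF f] in auto)
    then show ?thesis
      by eventually_elim auto
  qed
  have "L1_bounded_linear M P"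
    unfolding L1_bounded_linear_def
  proof (intro conjI allI impI)
    fix f g :: "'a \<Rightarrow> real" assume f: "integrable M f" and g: "integrable M g"
    show "AE x in M. P f x = P g x" if eq: "AE x in M. f x = g x"
    proof (rule unique[OF f P_int[OF g]])
      fix \<epsilon> :: real assume "0 < \<epsilon>"
      moreover have "L1_norm M (\<lambda>x. T t f x - P g x) = L1_norm M (\<lambda>x. T t g x - P g x)" if "t \<in> J" for t
      proof (rule L1_norm_cong)
        show "AE x in M. T t f x - P g x = T t g x - P g x"
          using T_cong[OF that f g eq] by eventually_elim auto
      qed (use f g P_int that in auto)
      ultimately show "\<exists>t0\<in>J. \<forall>t\<in>J. t0 \<le> t \<longrightarrow> L1_norm M (\<lambda>x. T t f x - P g x) \<le> \<epsilon>"
        using near[OF g] by simp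
    qed
    show "AE x in M. P (\<lambda>y. f y + g y) x = P f x + P g x"
    proof (rule unique)
      fix \<epsilon> :: real assume "0 < \<epsilon>"
      then have \<epsilon>: "0 < \<epsilon> / 2"
        by simp
      obtain t1 t2 where
        t1: "t1 \<in> J" "\<forall>t\<in>J. t1 \<le> t \<longrightarrow> L1_norm M (\<lambda>x. T t f x - P f x) \<le> \<epsilon> / 2" and
        t2: "t2 \<in> J" "\<forall>t\<in>J. t2 \<le> t \<longrightarrow> L1_norm M (\<lambda>x. T t g x - P g x) \<le> \<epsilon> / 2"
        using near[OF f \<epsilon>] near[OF g \<epsilon>] by blast
      have "L1_norm M (\<lambda>x. T t (\<lambda>y. f y + g y) x - (P f x + P g x)) \<le> \<epsilon>"
        if t: "t \<in> J" "max t1 t2 \<le> t" for t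
      proof -
        have "AE x in M. \<bar>T t (\<lambda>y. f y + g y) x - (P f x + P g x)\<bar>
            \<le> \<bar>T t f x - P f x\<bar> + \<bar>T t g x - P g x\<bar>"
          using T_add[OF t(1) f g] by eventually_elim auto
        then have "L1_norm M (\<lambda>x. T t (\<lambda>y. f y + g y) x - (P f x + P g x))
            \<le> L1_norm M (\<lambda>x. T t f x - P f x) + L1_norm M (\<lambda>x. T t g x - P g x)"
          using f g P_int t by (intro L1_norm_le_add) auto
        also have "\<dots> \<le> \<epsilon>"
          using t1(2)[rule_format, OF t(1)] t2(2)[rule_format, OF t(1)] t(2) by simp
        finally show ?thesis .
      qed
      moreover have "max t1 t2 \<in> J"
        using t1(1) t2(1) by (simp add: max_def)
      ultimately show "\<exists>t0\<in>J. \<forall>t\<in>J. t0 \<le> t \<longrightarrow>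
          L1_norm M (\<lambda>x. T t (\<lambda>y. f y + g y) x - (P f x + P g x)) \<le> \<epsilon>"
        by blast
    qed (use f g P_int in auto)
  next
    fix c :: real and f :: "'a \<Rightarrow> real" assume f: "integrable M f"
    show "AE x in M. P (\<lambda>y. c * f y) x = c * P f x"
    proof (rule unique)
      fix \<epsilon> :: real assume "0 < \<epsilon>"
      then have \<epsilon>: "0 < \<epsilon> / (\<bar>c\<bar> + 1)"
        by (intro divide_pos_pos) auto
      obtain t0 where
        t0: "t0 \<in> J" "\<forall>t\<in>J. t0 \<le> t \<longrightarrow> L1_norm M (\<lambda>x. T t f x - P f x) \<le> \<epsilon> / (\<bar>c\<bar> + 1)"
        using near[OF f \<epsilon>] by blast
      have "L1_norm M (\<lambda>x. T t (\<lambda>y. c * f y) x - c * P f x) \<le> \<epsilon>" if t: "t \<in> J" "t0 \<le> t" for t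
      proof -
        have "AE x in M. T t (\<lambda>y. c * f y) x - c * P f x = c * (T t f x - P f x)"
          using T_scale[OF t(1) f, of c] by eventually_elim (simp add: algebra_simps)
        then have "L1_norm M (\<lambda>x. T t (\<lambda>y. c * f y) x - c * P f x)
            = \<bar>c\<bar> * L1_norm M (\<lambda>x. T t f x - P f x)"
          using f P_int t by (subst L1_norm_scale[symmetric], intro L1_norm_cong) auto
        also have "\<dots> \<le> \<bar>c\<bar> * (\<epsilon> / (\<bar>c\<bar> + 1))"
          using t0(2) t by (intro mult_left_mono) auto
        also have "\<dots> \<le> \<epsilon>"
          using \<open>0 < \<epsilon>\<close> by (simp add: field_simps)
        finally show ?thesis .
      qed
      with t0(1) show "\<exists>t0\<in>J. \<forall>t\<in>J. t0 \<le> t \<longrightarrow> L1_norm M (\<lambda>x. T t (\<lambda>y. c * f y) x - c * P f x) \<le> \<epsilon>"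
        by blast
    qed (use f P_int in auto)
  next
    show "\<exists>C. \<forall>f. integrable M f \<longrightarrow> L1_norm M (P f) \<le> C * L1_norm M f"
    proof (intro exI[of _ K] allI impI)
      fix f :: "'a \<Rightarrow> real" assume f: "integrable M f"
      show "L1_norm M (P f) \<le> K * L1_norm M f"
      proof (rule field_le_epsilon)
        fix \<epsilon> :: real assume "0 < \<epsilon>"
        then obtain t where t: "t \<in> J" "L1_norm M (\<lambda>x. T t f x - P f x) \<le> \<epsilon>"
          using near[OF f] by blast
        have "L1_norm M (P f) \<le> L1_norm M (T t f) + L1_norm M (\<lambda>x. T t f x - P f x)"
          using f P_int t by (intro L1_norm_le_add AE_I2) auto
        also have "\<dots> \<le> K * L1_norm M f + \<epsilon>"
          by (intro add_mono bound t f)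
        finally show "L1_norm M (P f) \<le> K * L1_norm M f + \<epsilon>" .
      qed
    qed
  qed (fact P_int)
  with P show ?thesis
    unfolding L1_strongly_convergent_def by blast
qed

end

section \<open>Semigroups with uniformly nontrivial lower bounds\<close>

text \<open>
  The assumption \<open>c \<le> 1\<close>, like \<open>1 \<le> K\<close> before, can always be achieved by weakening the estimates;
  together they make the contraction factor \<open>1 - c\<^sup>2 / K\<close> nonnegative.
\<close>

locale lower_bounded_L1_semigroup = positive_L1_semigroup +
  fixes c :: real
  assumes c: "0 < c" "c \<le> 1"
    and lower_bound_exists: "\<And>f. integrable M f \<Longrightarrow> AE x in M. 0 \<le> f x \<Longrightarrow>
      \<exists>h. lower_bound f h \<and> c * L1_norm M f \<le> L1_norm M h"
begin

text \<open>
  The greatest lower bound \<open>h\<close> of \<open>f\<close> satisfies \<open>T\<^sub>s h \<le> h\<close>, because \<open>T\<^sub>s h\<close> is itself a lower bound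
  of \<open>f\<close>. The constant \<open>c\<^sup>2\<close> comes from using the hypothesis twice: for \<open>f\<close>, which makes \<open>h\<close>
  large, and for \<open>h\<close>, which keeps its decreasing orbit from losing more than the factor \<open>c\<close>.
\<close>

lemma convergent_lower_bound:
  assumes f: "integrable M f" "AE x in M. 0 \<le> f x"
  obtains h where "lower_bound f h" "Cauchy_orbit h"
    "\<And>s. s \<in> J \<Longrightarrow> c\<^sup>2 * L1_norm M f \<le> L1_norm M (T s h)"
proof -
  obtain h0 where h0: "lower_bound f h0" "c * L1_norm M f \<le> L1_norm M h0"
    using lower_bound_exists[OF f] by blast
  obtain h where h: "lower_bound f h" and greatest: "\<And>k. lower_bound f k \<Longrightarrow> AE x in M. k x \<le> h x"
    using greatest_lower_bound_exists[OF f(1) h0(1)] by blast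
  note hD = lower_boundD(1,2)[OF h] and h0D = lower_boundD(1,2)[OF h0(1)]
  have dec: "AE x in M. T s h x \<le> h x" if "s \<in> J" for s
    by (intro greatest lower_bound_T f h that)
  have "L1_norm M h0 \<le> L1_norm M h"
  proof (rule L1_norm_mono)
    show "AE x in M. \<bar>h0 x\<bar> \<le> \<bar>h x\<bar>"
      using greatest[OF h0(1)] h0D(2) by eventually_elim auto
  qed (use hD h0D in auto)
  obtain k where k: "lower_bound h k" "c * L1_norm M h \<le> L1_norm M k"
    using lower_bound_exists[OF hD] by blast
  have "c\<^sup>2 * L1_norm M f \<le> L1_norm M (T s h)" if s: "s \<in> J" for s
  proof -
    have "c\<^sup>2 * L1_norm M f \<le> c * L1_norm M h"
      using h0(2) \<open>L1_norm M h0 \<le> L1_norm M h\<close> c by (simp add: power2_eq_square)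
    also have "\<dots> \<le> L1_norm M k"
      by (fact k)
    also have "\<dots> \<le> L1_norm M (T s h)"
      by (rule lower_bound_norm_le[OF hD(1) k(1) s Cauchy_orbit_antitone(2)[OF hD dec s]])
    finally show ?thesis .
  qed
  with h Cauchy_orbit_antitone(1)[OF hD dec] that show ?thesis
    by blast
qed

text \<open>
  One step replaces \<open>f\<close> by the part \<open>g\<close> of \<open>T\<^sub>t f\<close> that exceeds a convergent lower bound. The bound
  \<open>B\<close> on the whole orbit, rather than on \<open>\<parallel>f\<parallel>\<close>, is what contracts: a single operator may increase
  the norm by the factor \<open>K\<close>, whereas the supremum along the orbit shrinks at every step. The number
  \<open>\<epsilon>\<close> absorbs the negative parts that are discarded on the way.
\<close>

lemma geometric_approximation:
  assumes "integrable M f" "AE x in M. 0 \<le> f x" "\<And>s. s \<in> J \<Longrightarrow> L1_norm M (T s f) \<le> B" "0 < \<epsilon>"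
  shows "\<exists>r\<in>J. \<exists>u. Cauchy_orbit u \<and>
    (\<forall>s\<in>J. L1_norm M (\<lambda>x. T (s + r) f x - T s u x) \<le> (1 - c\<^sup>2 / K) ^ n * B + \<epsilon>)"
  using assms
proof (induction n arbitrary: f B \<epsilon>)
  case 0
  have 1: "1 \<in> J"
    using time_set_Suc[OF J, of 0] by simp
  have "L1_norm M (\<lambda>x. T (s + 1) f x - T s (\<lambda>x. 0) x) \<le> (1 - c\<^sup>2 / K) ^ 0 * B + \<epsilon>" if s: "s \<in> J" for s
  proof -
    have s1: "s + 1 \<in> J"
      using time_set_add[OF J s 1] .
    have "AE x in M. T (s + 1) f x - T s (\<lambda>x. 0) x = T (s + 1) f x"
      using T_scale[OF s, of "\<lambda>x. 0" 0] by simp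
    then have "L1_norm M (\<lambda>x. T (s + 1) f x - T s (\<lambda>x. 0) x) = L1_norm M (T (s + 1) f)"
      using 0(1) s s1 by (intro L1_norm_cong) auto
    also have "\<dots> \<le> B"
      by (rule 0(3)[OF s1])
    finally show ?thesis
      using 0(4) by simp
  qed
  with 1 Cauchy_orbit_zero show ?case
    by blast
next
  case (Suc n)
  define q where "q = 1 - c\<^sup>2 / K"
  have "c\<^sup>2 \<le> 1"
    using c by (simp add: power_le_one)
  then have q: "0 \<le> q" "q \<le> 1"
    unfolding q_def using K by auto
  \<comment> \<open>One third of \<open>\<epsilon>\<close> goes to the bound for the orbit of \<open>g\<close>, one to the remaining \<open>n\<close> steps, and
    one to the orbit of the discarded part \<open>e\<close>.\<close>
  define \<delta> where "\<delta> = \<epsilon> / (3 * K)"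
  have \<delta>: "0 < \<delta>" "K * \<delta> = \<epsilon> / 3"
    unfolding \<delta>_def using K Suc.prems(4) by auto
  obtain h where h: "lower_bound f h" and h_conv: "Cauchy_orbit h"
    and h_large: "\<And>s. s \<in> J \<Longrightarrow> c\<^sup>2 * L1_norm M f \<le> L1_norm M (T s h)"
    using convergent_lower_bound[OF Suc.prems(1,2)] by blast
  note hD = lower_boundD(1,2)[OF h]
  obtain t where t: "t \<in> J" "L1_norm M (neg_part (\<lambda>x. T t f x - h x)) \<le> \<delta>"
    using lower_boundD(3)[OF h \<delta>(1)] by blast
  define e where "e = neg_part (\<lambda>x. T t f x - h x)"
  define g where "g x = max (T t f x - h x) 0" for x
  have e: "integrable M e" "\<And>x. 0 \<le> e x"
    unfolding e_def using Suc.prems(1) hD(1) t by (auto intro!: integrable_neg_part simp: neg_part_nonneg)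
  have g: "integrable M g" "AE x in M. 0 \<le> g x"
    unfolding g_def using Suc.prems(1) hD(1) t by auto
  have balance: "T t f x + e x = h x + g x" for x
    unfolding e_def g_def neg_part_def by auto
  have e_small: "L1_norm M (T s e) \<le> \<epsilon> / 3" if "s \<in> J" for s
  proof -
    have "L1_norm M (T s e) \<le> K * L1_norm M e"
      by (rule bound[OF that e(1)])
    also have "\<dots> \<le> K * \<delta>"
      using t(2) K unfolding e_def by (intro mult_left_mono) auto
    finally show ?thesis
      using \<delta>(2) by simp
  qed
  have T_balance: "AE x in M. T (s + t) f x + T s e x = T s h x + T s g x" if s: "s \<in> J" for s
  proof -
    have "AE x in M. T s (\<lambda>x. T t f x + e x) x = T s (T t f) x + T s e x"
      using Suc.prems(1) t e s by (intro T_add) auto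
    moreover have "AE x in M. T s (\<lambda>x. h x + g x) x = T s h x + T s g x"
      using hD g s by (intro T_add) auto
    moreover note T_semigroup[OF s t(1) Suc.prems(1)]
    ultimately show ?thesis
      unfolding balance by eventually_elim auto
  qed
  have g_bound: "L1_norm M (T s g) \<le> q * B + \<epsilon> / 3" if s: "s \<in> J" for s
  proof -
    have st: "s + t \<in> J"
      using time_set_add[OF J s t(1)] .
    have eAE: "AE x in M. 0 \<le> e x"
      using e(2) by simp
    have "L1_norm M (T s h) + L1_norm M (T s g) = L1_norm M (\<lambda>x. T s h x + T s g x)"
      using hD g s by (intro L1_norm_add_nonneg[symmetric] T_pos) auto
    also have "\<dots> = L1_norm M (\<lambda>x. T (s + t) f x + T s e x)"
    proof (rule L1_norm_cong)
      show "AE x in M. T s h x + T s g x = T (s + t) f x + T s e x"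
        using T_balance[OF s] by eventually_elim auto
    qed (use hD g Suc.prems(1) st s e in auto)
    also have "\<dots> \<le> L1_norm M (T (s + t) f) + L1_norm M (T s e)"
      using Suc.prems(1) st s e by (intro L1_norm_le_add AE_I2) auto
    finally have le: "L1_norm M (T s g) \<le> L1_norm M (T (s + t) f) + \<epsilon> / 3 - c\<^sup>2 * L1_norm M f"
      using e_small[OF s] h_large[OF s] by linarith
    \<comment> \<open>Since \<open>\<parallel>T\<^sub>s\<^sub>+\<^sub>t f\<parallel> \<le> K \<parallel>f\<parallel>\<close>, the loss \<open>c\<^sup>2 \<parallel>f\<parallel>\<close> is a fixed fraction of \<open>\<parallel>T\<^sub>s\<^sub>+\<^sub>t f\<parallel>\<close>.\<close>
    have "L1_norm M (T (s + t) f) - c\<^sup>2 * L1_norm M f \<le> L1_norm M (T (s + t) f) - c\<^sup>2 / K * L1_norm M (T (s + t) f)"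
    proof -
      have "c\<^sup>2 / K * L1_norm M (T (s + t) f) \<le> c\<^sup>2 / K * (K * L1_norm M f)"
        using bound[OF st Suc.prems(1)] K by (intro mult_left_mono) auto
      then show ?thesis
        using K by simp
    qed
    also have "\<dots> = q * L1_norm M (T (s + t) f)"
      unfolding q_def by (simp add: algebra_simps)
    also have "\<dots> \<le> q * B"
      using q(1) Suc.prems(3)[OF st] by (intro mult_left_mono)
    finally show ?thesis
      using le by linarith
  qed
  have "0 < \<epsilon> / 3"
    using Suc.prems(4) by simp
  from Suc.IH[OF g g_bound this] obtain r u where r: "r \<in> J" and u: "Cauchy_orbit u"
    and close: "\<And>s. s \<in> J \<Longrightarrow> L1_norm M (\<lambda>x. T (s + r) g x - T s u x) \<le> q ^ n * (q * B + \<epsilon> / 3) + \<epsilon> / 3"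
    unfolding q_def by blast
  have u_int: "integrable M u"
    using u by (rule Cauchy_orbitD(1))
  show ?case
  proof (intro bexI exI conjI ballI)
    show "r + t \<in> J"
      by (rule time_set_add[OF J r t(1)])
    show "Cauchy_orbit (\<lambda>x. T r h x + u x)"
      by (intro Cauchy_orbit_add Cauchy_orbit_T h_conv r u)
    fix s assume s: "s \<in> J"
    have sr: "s + r \<in> J" "s + (r + t) \<in> J"
      using s r t time_set_add[OF J] by auto
    have "AE x in M. \<bar>T (s + (r + t)) f x - T s (\<lambda>x. T r h x + u x) x\<bar>
        \<le> \<bar>T (s + r) g x - T s u x\<bar> + \<bar>T (s + r) e x\<bar>"
      using T_balance[OF sr(1)] T_semigroup[OF s r hD(1)] T_add[OF s T_int[OF r hD(1)] u_int]
      by eventually_elim (auto simp: add.assoc)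
    then have "L1_norm M (\<lambda>x. T (s + (r + t)) f x - T s (\<lambda>x. T r h x + u x) x)
        \<le> L1_norm M (\<lambda>x. T (s + r) g x - T s u x) + L1_norm M (T (s + r) e)"
      using Suc.prems(1) s sr r g e hD(1) u_int by (intro L1_norm_le_add) auto
    also have "\<dots> \<le> q ^ n * (q * B + \<epsilon> / 3) + \<epsilon> / 3 + \<epsilon> / 3"
      by (intro add_mono close e_small s sr)
    also have "\<dots> \<le> q ^ Suc n * B + \<epsilon>"
    proof -
      have "q ^ n * (\<epsilon> / 3) \<le> 1 * (\<epsilon> / 3)"
        using q Suc.prems(4) by (intro mult_right_mono) (auto simp: power_le_one)
      then show ?thesis
        by (simp add: algebra_simps)
    qed
    finally show "L1_norm M (\<lambda>x. T (s + (r + t)) f x - T s (\<lambda>x. T r h x + u x) x)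
        \<le> (1 - c\<^sup>2 / K) ^ Suc n * B + \<epsilon>"
      unfolding q_def .
  qed
qed

lemma Cauchy_orbit_nonneg:
  assumes f: "integrable M f" "AE x in M. 0 \<le> f x"
  shows "Cauchy_orbit f"
proof (rule Cauchy_orbit_approx[OF f(1)])
  fix \<epsilon> :: real assume "0 < \<epsilon>"
  define q where "q = 1 - c\<^sup>2 / K"
  define B where "B = K * L1_norm M f"
  have "c\<^sup>2 \<le> 1" "0 < c\<^sup>2"
    using c by (auto simp: power_le_one)
  then have q: "0 \<le> q" "q < 1"
    unfolding q_def using K by auto
  have "(\<lambda>n. q ^ n * B) \<longlonglongrightarrow> 0 * B"
    using q by (intro tendsto_intros LIMSEQ_power_zero) auto
  then have "\<forall>\<^sub>F n in sequentially. q ^ n * B < \<epsilon> / 2"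
    using \<open>0 < \<epsilon>\<close> by (intro order_tendstoD(2)[of _ "0 * B"]) auto
  then obtain n where n: "q ^ n * B < \<epsilon> / 2"
    unfolding eventually_sequentially by blast
  have "\<exists>r\<in>J. \<exists>u. Cauchy_orbit u \<and>
      (\<forall>s\<in>J. L1_norm M (\<lambda>x. T (s + r) f x - T s u x) \<le> q ^ n * B + \<epsilon> / 2)"
    unfolding q_def B_def using \<open>0 < \<epsilon>\<close> by (intro geometric_approximation f bound) auto
  then obtain r u where "r \<in> J" "Cauchy_orbit u"
    and close: "\<And>s. s \<in> J \<Longrightarrow> L1_norm M (\<lambda>x. T (s + r) f x - T s u x) \<le> q ^ n * B + \<epsilon> / 2"
    by blast
  moreover have "L1_norm M (\<lambda>x. T (s + r) f x - T s u x) \<le> \<epsilon>" if "s \<in> J" for s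
    using close[OF that] n by linarith
  ultimately show "\<exists>r\<in>J. \<exists>u. Cauchy_orbit u \<and> (\<forall>s\<in>J. L1_norm M (\<lambda>x. T (s + r) f x - T s u x) \<le> \<epsilon>)"
    by blast
qed

lemma strongly_convergent: "L1_strongly_convergent M J T"
proof (rule strongly_convergent_if_Cauchy_orbits)
  fix f :: "'a \<Rightarrow> real" assume f: "integrable M f"
  have "Cauchy_orbit (\<lambda>x. max (f x) 0 + (-1) * max (- f x) 0)"
    using f by (intro Cauchy_orbit_add Cauchy_orbit_scale Cauchy_orbit_nonneg) auto
  also have "(\<lambda>x. max (f x) 0 + (-1) * max (- f x) 0) = f"
    by (auto simp: max_def)
  finally show "Cauchy_orbit f" .
qed

end

section \<open>Strong convergence\<close>

theorem theorem1p1: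
  fixes M :: "'a measure" and J :: "real set"
    and T :: "real \<Rightarrow> ('a \<Rightarrow> real) \<Rightarrow> ('a \<Rightarrow> real)"
  assumes "time_set J"
    and "L1_bounded_semigroup M J T"
    and "L1_positive M J T"
    and "\<exists>h :: ('a \<Rightarrow> real) \<Rightarrow> ('a \<Rightarrow> real).
           (\<forall>f\<in>L1_normalised M.
              integrable M (h f) \<and> (AE x in M. 0 \<le> h f x) \<and>
              ((\<lambda>t. L1_norm M (neg_part (\<lambda>x. T t f x - h f x))) \<longlongrightarrow> 0) (at_top_in J)) \<and>
           (INF f\<in>L1_normalised M. ennreal (L1_norm M (h f))) > 0"
  shows "L1_strongly_convergent M J T"
proof -
  have semigroup: "L1_semigroup M J T" and bdd: "bdd_above ((\<lambda>t. L1_onorm M (T t)) ` J)"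
    using assms(2) unfolding L1_bounded_semigroup_def by auto
  obtain K0 where K0: "\<And>t. t \<in> J \<Longrightarrow> L1_onorm M (T t) \<le> K0"
    using bdd unfolding bdd_above_def by blast
  define K where "K = max 1 K0"
  interpret positive_L1_semigroup M J T K
  proof
    fix t and f :: "'a \<Rightarrow> real" assume t: "t \<in> J" and f: "integrable M f"
    have "L1_norm M (T t f) \<le> L1_onorm M (T t) * L1_norm M f"
      using semigroup t f unfolding L1_semigroup_def by (intro L1_norm_le_onorm) auto
    also have "\<dots> \<le> K * L1_norm M f"
      using K0[OF t] unfolding K_def by (intro mult_right_mono L1_norm_nonneg) auto
    finally show "L1_norm M (T t f) \<le> K * L1_norm M f" .
  qed (auto simp: K_def assms semigroup)
  obtain h where h: "\<And>f. f \<in> L1_normalised M \<Longrightarrow> integrable M (h f) \<and> (AE x in M. 0 \<le> h f x) \<and>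
        ((\<lambda>t. L1_norm M (neg_part (\<lambda>x. T t f x - h f x))) \<longlongrightarrow> 0) (at_top_in J)"
    and INF_pos: "(INF f\<in>L1_normalised M. ennreal (L1_norm M (h f))) > 0"
    using assms(4) by blast
  \<comment> \<open>The infimum is \<open>\<infinity>\<close> if there is no normalised function, so it is cut off at \<open>1\<close>.\<close>
  define i where "i = min 1 (INF f\<in>L1_normalised M. ennreal (L1_norm M (h f)))"
  define c where "c = enn2real i"
  have i: "0 < i" "i \<le> 1"
    using INF_pos unfolding i_def by auto
  then have i_fin: "i < top"
    using le_less_trans ennreal_one_less_top by blast
  have c: "0 < c" "c \<le> 1"
    unfolding c_def using i i_fin by (auto simp: enn2real_positive_iff intro: enn2real_leI)
  have c_le: "c \<le> L1_norm M (h f)" if "f \<in> L1_normalised M" for f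
  proof -
    have "i \<le> ennreal (L1_norm M (h f))"
      unfolding i_def using that by (intro min.coboundedI2 INF_lower)
    then show ?thesis
      unfolding c_def by (intro enn2real_leI L1_norm_nonneg)
  qed
  have lb: "lower_bound f (h f)" if "f \<in> L1_normalised M" for f
  proof -
    have "\<forall>\<epsilon>>0. \<exists>t0\<in>J. \<forall>t\<in>J. t0 \<le> t \<longrightarrow> L1_norm M (neg_part (\<lambda>x. T t f x - h f x)) \<le> \<epsilon>"
      using h[OF that] by (subst tendsto_0_at_top_in[OF J L1_norm_nonneg, symmetric]) blast
    with h[OF that] show ?thesis
      unfolding lower_bound_def by blast
  qed
  interpret lower_bounded_L1_semigroup M J T K c
  proof
    fix f :: "'a \<Rightarrow> real" assume f: "integrable M f" "AE x in M. 0 \<le> f x"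
    show "\<exists>k. lower_bound f k \<and> c * L1_norm M f \<le> L1_norm M k"
    proof (cases "L1_norm M f = 0")
      case True
      have "L1_norm M (neg_part (\<lambda>x. T t f x - 0)) = 0" if "t \<in> J" for t
      proof -
        have "AE x in M. neg_part (\<lambda>x. T t f x - 0) x = 0"
          using T_pos[OF that f] by eventually_elim (auto simp: neg_part_def)
        moreover have "integrable M (neg_part (\<lambda>x. T t f x - 0))"
          using that f by (intro integrable_neg_part) auto
        ultimately show ?thesis
          by (simp add: L1_norm_eq_0_iff)
      qed
      then have "lower_bound f (\<lambda>x. 0)"
        unfolding lower_bound_def using time_set_Suc[OF J, of 0] by fastforce
      with True show ?thesis
        by force
    next
      case False
      define a where "a = L1_norm M f"
      have a: "0 < a"
        using False L1_norm_nonneg[of M f] unfolding a_def by simp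
      define f1 where "f1 x = inverse a * f x" for x
      have f1_int: "integrable M f1"
        unfolding f1_def using f by auto
      have f1: "f1 \<in> L1_normalised M"
        unfolding L1_normalised_def
      proof (intro CollectI conjI)
        show "AE x in M. 0 \<le> f1 x"
          using f(2) by eventually_elim (use a in \<open>simp add: f1_def\<close>)
        show "L1_norm M f1 = 1"
          unfolding f1_def L1_norm_scale using a by (simp add: a_def)
      qed (fact f1_int)
      have "lower_bound f (\<lambda>x. a * h f1 x)"
        using lower_bound_scale[OF f1_int lb[OF f1], of a] a by (simp add: f1_def field_simps)
      moreover have "c * L1_norm M f \<le> L1_norm M (\<lambda>x. a * h f1 x)"
        unfolding L1_norm_scale using c_le[OF f1] a by (simp add: a_def mult.commute)
      ultimately show ?thesis
        by blast
    qed
  qed (fact c)+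
  show ?thesis
    by (rule strongly_convergent)
qed

end
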